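(* Let $\mathbf F^{[\nu]}\in\mathcal C^3$ be Lipschitz continuous for $\nu=1,\dots,N$ and let $\mathbf A,\mathbf b,\mathbf c$ describe an explicit $2$-stage Runge--Kutta method of order two. Then the corresponding MPRK scheme (see context, $s=2$) is of order two if and only if $$\rho_{2\nu}=y^n_\nu+\mathcal O(h),\quad\nu=1,\dots,N,\qquad\text{and}\qquad \sigma_\mu=\big(\mathrm{NB}_1(\tfrac1\gamma,\mathbf y^n)\big)_\mu+\mathcal O(h^2),\quad\mu=1,\dots,N.$$
   Context: All $\mathcal O$-statements are with respect to $h\to0$. MPRK scheme: applied to a production-destruction system $y_m'=\sum_{\nu=1}^N(p_{m\nu}(\mathbf y)-d_{m\nu}(\mathbf y))$, $m=1,\dots,N$, with $p_{m\nu}=d_{\nu m}$, $p_{mm}=d_{mm}=0$, and $p_{m\nu},d_{m\nu}\ge 0$ (for positive arguments), starting from a positive vector $\mathbf y^n\in\mathbb R^N$, it reads $$y^{(i)}_m=y^n_m+h\sum_{j=1}^{i-1}a_{ij}\sum_{\nu=1}^N\Big(p_{m\nu}(\mathbf y^{(j)})\frac{y^{(i)}_\nu}{\rho_{i\nu}}-d_{m\nu}(\mathbf y^{(j)})\frac{y^{(i)}_m}{\rho_{im}}\Big),\ i=1,\dots,s,\qquad y^{n+1}_m=y^n_m+h\sum_{j=1}^{s}b_{j}\sum_{\nu=1}^N\Big(p_{m\nu}(\mathbf y^{(j)})\frac{y^{n+1}_\nu}{\sigma_{\nu}}-d_{m\nu}(\mathbf y^{(j)})\frac{y^{n+1}_m}{\sigma_{m}}\Big),$$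 $m=1,\dots,N$, with $a_{ij},b_j\ge0$ and $c_i=\sum_j a_{ij}$. The Patankar-weight denominators $\rho_{i\nu}=\rho_{i\nu}(\mathbf y^n,\mathbf y^{(1)},\dots,\mathbf y^{(i-1)})$ ($i\ge2$) and $\sigma_\nu=\sigma_\nu(\mathbf y^n,\mathbf y^{(1)},\dots,\mathbf y^{(s)})$ are continuous functions of their arguments and positive for all $h\ge0$. $\mathbf F^{[\nu]}$ has components $F^{[\nu]}_m=p_{m\nu}$ for $\nu\neq m$ and $F^{[m]}_m=-\sum_{j}d_{mj}$, so the system is $\mathbf y'=\mathbf F(\mathbf y)=\sum_{\nu=1}^N\mathbf F^{[\nu]}(\mathbf y)$. Order $p$ (at least): whenever $\mathbf y^n=\mathbf y(t_n)$ for a (positive) solution, $\mathbf y^{n+1}=\mathbf y(t_n+h)+\mathcal O(h^{p+1})$; as usual, order statements refer to the whole class of right-hand sides with the stated regularity, the elementary differentials belonging to different colored rooted trees being regarded as linearly independent. $\mathrm{NB}_1(\tfrac1\gamma,\mathbf y)=\mathbf y+h\sum_{\mu=1}^N\mathbf F^{[\mu]}(\mathbf y)=\mathbf y+h\mathbf F(\mathbf y)$ (the truncated NB-series of the exact solution over colored rooted trees with one node). *)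

theory Defs
  imports "HOL-Analysis.Analysis" "HOL-Library.Landau_Symbols"
begin

(* Class C^k on an open set S. In finite dimension, continuity of all iterated
   directional derivatives up to order k is continuity of the k-th Frechet derivative. *)
primrec Ck_on :: "nat \<Rightarrow> ('a::euclidean_space \<Rightarrow> 'b::real_normed_vector) \<Rightarrow> 'a set \<Rightarrow> bool" where
  "Ck_on 0 f S \<longleftrightarrow> continuous_on S f"
| "Ck_on (Suc k) f S \<longleftrightarrow>
     (\<forall>x\<in>S. f differentiable (at x)) \<and> (\<forall>v. Ck_on k (\<lambda>x. frechet_derivative f (at x) v) S)"

definition positive_vectors :: "(real ^ 'n) set" where
  "positive_vectors = {y. \<forall>m. y $ m > 0}"

definition local_solution :: "('a::real_normed_vector \<Rightarrow> 'a) \<Rightarrow> 'a set \<Rightarrow> real \<Rightarrow> (real \<Rightarrow> 'a) \<Rightarrow> bool" where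
  "local_solution f S t y \<longleftrightarrow>
     (\<exists>\<delta>>0. \<forall>s\<in>{t..<t+\<delta>}. y s \<in> S \<and>
        (y has_vector_derivative f (y s)) (at s within {t..<t+\<delta>}))"

(* A one-step method is a relation Phi h y z between step size, y^n and y^(n+1), as the
   schemes below are given by (linearly) implicit equations. The order condition is
   local: one step from an exact solution has error O(h^(p+1)) as h tends to 0 from above. *)
definition has_order :: "nat \<Rightarrow> (real \<Rightarrow> 'a \<Rightarrow> 'a \<Rightarrow> bool) \<Rightarrow> ('a::real_normed_vector \<Rightarrow> 'a) \<Rightarrow> 'a set \<Rightarrow> bool" where
  "has_order p \<Phi> f S \<longleftrightarrow>
     (\<forall>t y z. local_solution f S t y \<and> (\<forall>\<^sub>F h in at_right 0. \<Phi> h (y t) (z h)) \<longrightarrow>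
        (\<lambda>h. norm (z h - y (t + h))) \<in> O[at_right 0](\<lambda>h. h ^ (p + 1)))"


subsection \<open>Runge--Kutta methods\<close>

definition explicit_tableau :: "nat \<Rightarrow> (nat \<Rightarrow> nat \<Rightarrow> real) \<Rightarrow> (nat \<Rightarrow> real) \<Rightarrow> bool" where
  "explicit_tableau s a c \<longleftrightarrow>
     (\<forall>i\<in>{1..s}. \<forall>j\<in>{i..s}. a i j = 0) \<and> (\<forall>i\<in>{1..s}. c i = (\<Sum>j=1..s. a i j))"

definition rk_step ::
  "('a::real_normed_vector \<Rightarrow> 'a) \<Rightarrow> nat \<Rightarrow> (nat \<Rightarrow> nat \<Rightarrow> real) \<Rightarrow> (nat \<Rightarrow> real) \<Rightarrow> real \<Rightarrow> 'a \<Rightarrow> 'a \<Rightarrow> bool" where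
  "rk_step f s a b h y z \<longleftrightarrow>
     (\<exists>Y. (\<forall>i\<in>{1..s}. Y i = y + h *\<^sub>R (\<Sum>j=1..s. a i j *\<^sub>R f (Y j))) \<and>
          z = y + h *\<^sub>R (\<Sum>j=1..s. b j *\<^sub>R f (Y j)))"

(* The type argument is the state space of the differential equations considered. *)
definition rk_order ::
  "'a::euclidean_space itself \<Rightarrow> nat \<Rightarrow> nat \<Rightarrow> (nat \<Rightarrow> nat \<Rightarrow> real) \<Rightarrow> (nat \<Rightarrow> real) \<Rightarrow> bool" where
  "rk_order _ p s a b \<longleftrightarrow>
     (\<forall>f :: 'a \<Rightarrow> 'a. Ck_on (p + 1) f UNIV \<and> (\<exists>L. L-lipschitz_on UNIV f) \<longrightarrow>
        has_order p (rk_step f s a b) f UNIV)"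


subsection \<open>Production-destruction systems\<close>

type_synonym 'n rates = "'n \<Rightarrow> 'n \<Rightarrow> real ^ 'n \<Rightarrow> real"

(* The part F^[nu] of the right-hand side belonging to the colour nu. *)
definition pds_part :: "'n::finite rates \<Rightarrow> 'n rates \<Rightarrow> 'n \<Rightarrow> real ^ 'n \<Rightarrow> real ^ 'n" where
  "pds_part p d \<nu> y = (\<chi> m. if m = \<nu> then - (\<Sum>j\<in>UNIV. d m j y) else p m \<nu> y)"

definition pds_rhs :: "'n::finite rates \<Rightarrow> 'n rates \<Rightarrow> real ^ 'n \<Rightarrow> real ^ 'n" where
  "pds_rhs p d y = (\<Sum>\<nu>\<in>UNIV. pds_part p d \<nu> y)"

definition pds :: "(real ^ 'n::finite) set \<Rightarrow> 'n rates \<Rightarrow> 'n rates \<Rightarrow> bool" where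
  "pds D p d \<longleftrightarrow>
     (\<forall>y\<in>D. \<forall>m \<nu>. p m \<nu> y = d \<nu> m y \<and> p m m y = 0 \<and> d m m y = 0) \<and>
     (\<forall>y\<in>positive_vectors. \<forall>m \<nu>. p m \<nu> y \<ge> 0 \<and> d m \<nu> y \<ge> 0) \<and>
     (\<forall>\<nu>. Ck_on 3 (pds_part p d \<nu>) D \<and> (\<exists>L. L-lipschitz_on D (pds_part p d \<nu>)))"

(* The NB-series of the exact solution truncated after the trees with one node (gamma = 1). *)
definition NB1 :: "'n::finite rates \<Rightarrow> 'n rates \<Rightarrow> real \<Rightarrow> real ^ 'n \<Rightarrow> real ^ 'n" where
  "NB1 p d h y = y + h *\<^sub>R (\<Sum>\<mu>\<in>UNIV. pds_part p d \<mu> y)"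


subsection \<open>Modified Patankar--Runge--Kutta schemes\<close>

(* The Patankar-weighted equation shared by the stages and the update: the unknown is z,
   w holds the k Runge--Kutta weights in use, Y the stages and r the denominators.
   For positive r and Y, nonnegative w and h \<ge> 0 its matrix is an M-matrix, so z is
   uniquely determined. *)
definition patankar_eq ::
  "'n::finite rates \<Rightarrow> 'n rates \<Rightarrow> real \<Rightarrow> real ^ 'n \<Rightarrow> (nat \<Rightarrow> real) \<Rightarrow> nat \<Rightarrow> (nat \<Rightarrow> real ^ 'n) \<Rightarrow>
   real ^ 'n \<Rightarrow> real ^ 'n \<Rightarrow> bool" where
  "patankar_eq p d h y w k Y r z \<longleftrightarrow>
     (\<forall>m. z $ m = y $ m + h * (\<Sum>j=1..k. w j *
        (\<Sum>\<nu>\<in>UNIV. p m \<nu> (Y j) * (z $ \<nu> / r $ \<nu>) - d m \<nu> (Y j) * (z $ m / r $ m))))"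

(* R i y Y and S y Y are the denominators of stage i and of the update. The sum for
   stage i = 1 is empty, so Y 1 = y and R 1 is irrelevant. *)
definition mprk_stages ::
  "'n::finite rates \<Rightarrow> 'n rates \<Rightarrow> nat \<Rightarrow> (nat \<Rightarrow> nat \<Rightarrow> real) \<Rightarrow>
   (nat \<Rightarrow> real ^ 'n \<Rightarrow> (nat \<Rightarrow> real ^ 'n) \<Rightarrow> real ^ 'n) \<Rightarrow>
   real \<Rightarrow> real ^ 'n \<Rightarrow> (nat \<Rightarrow> real ^ 'n) \<Rightarrow> bool" where
  "mprk_stages p d s a R h y Y \<longleftrightarrow>
     (\<forall>i\<in>{1..s}. patankar_eq p d h y (a i) (i - 1) Y (R i y Y) (Y i))"

definition mprk_step ::
  "'n::finite rates \<Rightarrow> 'n rates \<Rightarrow> nat \<Rightarrow> (nat \<Rightarrow> nat \<Rightarrow> real) \<Rightarrow> (nat \<Rightarrow> real) \<Rightarrow>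
   (nat \<Rightarrow> real ^ 'n \<Rightarrow> (nat \<Rightarrow> real ^ 'n) \<Rightarrow> real ^ 'n) \<Rightarrow>
   (real ^ 'n \<Rightarrow> (nat \<Rightarrow> real ^ 'n) \<Rightarrow> real ^ 'n) \<Rightarrow>
   real \<Rightarrow> real ^ 'n \<Rightarrow> real ^ 'n \<Rightarrow> bool" where
  "mprk_step p d s a b R S h y z \<longleftrightarrow>
     (\<exists>Y. mprk_stages p d s a R h y Y \<and> patankar_eq p d h y b s Y (S y Y) z)"

end

theory Submission
  imports Defs
begin

text \<open>
  The first stage is \<open>y\<close> itself, so \<open>\<rho>\<close> is only ever evaluated at \<open>(y, y)\<close>, and the second
  stage \<open>x h\<close>, hence also \<open>\<sigma> y y (x h)\<close>, depends on the system only through the matrix of rates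
  at \<open>y\<close>. Sufficiency of the conditions is a bootstrap: each error order of \<open>z - \<sigma>\<close> gives one more
  order of \<open>z\<close>, where \<open>z\<close> is the update.

  For necessity, explicitly solvable systems suffice. A single constant rate from \<open>\<nu>\<close> to \<open>m\<close> gives
  \<open>\<sigma> y y y = y\<close>. The linear rate \<open>x\<^sub>\<nu> / y\<^sub>\<nu>\<close> has the same second stage, and comparing both
  updates gives \<open>\<rho> y y = y\<close>. For a constant rate matrix \<open>P\<close> with right-hand side \<open>F\<close>, order two
  says that \<open>\<theta> = (y + h F) / \<sigma> - 1\<close> is mapped by the Patankar operator of \<open>P\<close> to \<open>O(h\<^sup>2)\<close>. This
  operator is singular, but adding the symmetric rates \<open>y\<^sub>m y\<^sub>\<nu> / S\<close> with \<open>S = \<Sum>\<^sub>\<nu> y\<^sub>\<nu>\<close> to \<open>P\<close> leaves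
  \<open>F\<close> unchanged and merely reparametrizes the curve of second stages by \<open>h \<mapsto> h / (1 - a\<^sub>2\<^sub>1 h)\<close>,
  because \<open>\<Sum>\<^sub>\<nu> x\<^sub>\<nu>\<close> is conserved. Subtracting the two statements shows that \<open>\<theta>\<close> is a multiple
  \<open>l\<close> of the all-ones vector up to \<open>O(h\<^sup>2)\<close>, and then \<open>l F = O(h\<^sup>2)\<close>. If \<open>F = 0\<close>, the curve is constant.
\<close>

subsection \<open>Asymptotics for small step sizes\<close>

text \<open>The order symbol \<open>O(h^k)\<close> for vector-valued curves, with an explicit
  constant. The filter sees only \<open>h > 0\<close>, so the bound \<open>C * h ^ k\<close> carries
  no absolute value; \<open>hO_iff_bigo\<close> is the bridge to the Landau symbol.\<close>

definition hO :: "nat \<Rightarrow> (real \<Rightarrow> 'a::real_normed_vector) \<Rightarrow> bool" where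
  "hO k f \<longleftrightarrow> (\<exists>C. \<forall>\<^sub>F h in at_right 0. norm (f h) \<le> C * h ^ k)"

lemma eventually_at_right_0: "(\<And>h::real. 0 < h \<Longrightarrow> h < e \<Longrightarrow> P h) \<Longrightarrow> 0 < e \<Longrightarrow> \<forall>\<^sub>F h in at_right 0. P h"
  unfolding eventually_at_right_field by blast

lemma eventually_small: "0 < e \<Longrightarrow> \<forall>\<^sub>F h::real in at_right 0. 0 < h \<and> h < e"
  by (rule eventually_at_right_0[of e]) auto

lemma hO_nonneg_const:
  assumes "hO k f" shows "\<exists>C\<ge>0. \<forall>\<^sub>F h in at_right 0. norm (f h) \<le> C * h ^ k"
proof -
  obtain C where "\<forall>\<^sub>F h in at_right 0. norm (f h) \<le> C * h ^ k" using assms by (auto simp: hO_def)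
  then have "\<forall>\<^sub>F h in at_right 0. norm (f h) \<le> max C 0 * h ^ k"
    using eventually_small[of 1, simplified]
    by eventually_elim (smt (verit) max.cobounded1 mult_right_mono zero_le_power)
  then show ?thesis by (intro exI[of _ "max C 0"]) auto
qed

lemma hO_iff_bigo: "hO k f \<longleftrightarrow> (\<lambda>h. norm (f h)) \<in> O[at_right 0](\<lambda>h. h ^ k)"
proof
  assume "hO k f"
  then obtain C where C: "\<forall>\<^sub>F h in at_right 0. norm (f h) \<le> C * h ^ k" by (auto simp: hO_def)
  have "\<forall>\<^sub>F h in at_right 0. norm (norm (f h)) \<le> C * norm (h ^ k)"
    using C eventually_small[of 1, simplified] by eventually_elim auto
  then show "(\<lambda>h. norm (f h)) \<in> O[at_right 0](\<lambda>h. h ^ k)" by (rule bigoI)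
next
  assume "(\<lambda>h. norm (f h)) \<in> O[at_right 0](\<lambda>h. h ^ k)"
  then obtain C where C: "\<forall>\<^sub>F h in at_right 0. norm (norm (f h)) \<le> C * norm (h ^ k)"
    by (elim landau_o.bigE)
  have "\<forall>\<^sub>F h in at_right 0. norm (f h) \<le> C * h ^ k"
    using C eventually_small[of 1, simplified] by eventually_elim auto
  then show "hO k f" by (auto simp: hO_def)
qed

lemma hO_real_iff_bigo:
  fixes f :: "real \<Rightarrow> real"
  shows "hO k f \<longleftrightarrow> f \<in> O[at_right 0](\<lambda>h. h ^ k)"
  unfolding hO_iff_bigo by simp

lemma hO_cong:
  assumes "\<forall>\<^sub>F h in at_right 0. f h = g h" "hO k f" shows "hO k g"
proof -
  obtain C where "\<forall>\<^sub>F h in at_right 0. norm (f h) \<le> C * h ^ k" using assms(2) by (auto simp: hO_def)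
  with assms(1) have "\<forall>\<^sub>F h in at_right 0. norm (g h) \<le> C * h ^ k" by eventually_elim auto
  then show ?thesis by (auto simp: hO_def)
qed

lemma hO_eq: "hO k f \<Longrightarrow> (\<And>h. f h = g h) \<Longrightarrow> hO k g"
  by (simp add: hO_def)

lemma hO_le:
  assumes "\<forall>\<^sub>F h in at_right 0. norm (f h) \<le> norm (g h)" "hO k g" shows "hO k f"
proof -
  obtain C where "\<forall>\<^sub>F h in at_right 0. norm (g h) \<le> C * h ^ k" using assms(2) by (auto simp: hO_def)
  with assms(1) have "\<forall>\<^sub>F h in at_right 0. norm (f h) \<le> C * h ^ k" by eventually_elim auto
  then show ?thesis by (auto simp: hO_def)
qed

lemma hO_add:
  assumes "hO k f" "hO k g" shows "hO k (\<lambda>h. f h + g h)"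
proof -
  obtain C D where "\<forall>\<^sub>F h in at_right 0. norm (f h) \<le> C * h ^ k"
    "\<forall>\<^sub>F h in at_right 0. norm (g h) \<le> D * h ^ k" using assms by (auto simp: hO_def)
  then have "\<forall>\<^sub>F h in at_right 0. norm (f h + g h) \<le> (C + D) * h ^ k"
    by eventually_elim (auto simp: algebra_simps intro: norm_triangle_le add_mono)
  then show ?thesis by (auto simp: hO_def)
qed

lemma hO_minus_iff: "hO k (\<lambda>h. - f h) \<longleftrightarrow> hO k f"
  by (simp add: hO_def)

lemma hO_diff:
  assumes "hO k f" "hO k g" shows "hO k (\<lambda>h. f h - g h)"
  using hO_add[OF assms(1), of "\<lambda>h. - g h"] assms(2) by (simp add: hO_minus_iff)

lemma hO_zero: "hO k (\<lambda>h. 0)"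
  by (auto simp: hO_def intro!: exI[of _ 0])

lemma hO_const: "hO 0 (\<lambda>h. c)"
  by (auto simp: hO_def intro!: exI[of _ "norm c"])

lemma hO_sum:
  assumes "\<And>i. i \<in> A \<Longrightarrow> hO k (f i)" shows "hO k (\<lambda>h. \<Sum>i\<in>A. f i h)"
  using assms by (induction A rule: infinite_finite_induct) (auto intro: hO_zero hO_add)

lemma hO_mono:
  assumes "hO k f" "j \<le> k" shows "hO j f"
proof -
  obtain C where C: "C \<ge> 0" "\<forall>\<^sub>F h in at_right 0. norm (f h) \<le> C * h ^ k"
    using hO_nonneg_const[OF assms(1)] by auto
  have "\<forall>\<^sub>F h in at_right 0. norm (f h) \<le> C * h ^ j"
    using C(2) eventually_small[of 1, simplified]
  proof eventually_elim
    case (elim h)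
    then have "h ^ k \<le> h ^ j" using assms(2) by (intro power_decreasing) auto
    then show ?case using elim C(1) by (meson mult_left_mono order_trans)
  qed
  then show ?thesis by (auto simp: hO_def)
qed

lemma hO_scaleR:
  assumes "hO j f" "hO k g" shows "hO (j + k) (\<lambda>h. f h *\<^sub>R g h)"
proof -
  obtain C where C: "C \<ge> 0" "\<forall>\<^sub>F h in at_right 0. norm (f h) \<le> C * h ^ j"
    using hO_nonneg_const[OF assms(1)] by auto
  obtain D where D: "D \<ge> 0" "\<forall>\<^sub>F h in at_right 0. norm (g h) \<le> D * h ^ k"
    using hO_nonneg_const[OF assms(2)] by auto
  have "\<forall>\<^sub>F h in at_right 0. norm (f h *\<^sub>R g h) \<le> (C * D) * h ^ (j + k)"
    using C(2) D(2) eventually_small[of 1, simplified]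
  proof eventually_elim
    case (elim h)
    then have "norm (f h) * norm (g h) \<le> (C * h ^ j) * (D * h ^ k)"
      using C(1) by (intro mult_mono) auto
    then show ?case by (simp add: power_add mult_ac)
  qed
  then show ?thesis by (auto simp: hO_def)
qed

lemma hO_mult:
  fixes f g :: "real \<Rightarrow> real"
  shows "hO j f \<Longrightarrow> hO k g \<Longrightarrow> hO (j + k) (\<lambda>h. f h * g h)"
  using hO_scaleR[of j f k g] by simp

lemma hO_power: "hO k (\<lambda>h. h ^ k)"
  by (auto simp: hO_def intro!: exI[of _ 1] eventually_mono[OF eventually_small[of 1]])

lemma hO_step: "hO k f \<Longrightarrow> hO (Suc k) (\<lambda>h. h *\<^sub>R f h)"
  using hO_scaleR[OF hO_power[of 1], of k f] by simp

text \<open>On the filter \<open>h\<close> is positive and can be divided out. This turns one-step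
  errors into statements on coefficients and Patankar weights.\<close>

lemma hO_step_cancel:
  assumes "hO (Suc k) (\<lambda>h. h *\<^sub>R f h)" shows "hO k f"
proof -
  obtain C where "\<forall>\<^sub>F h in at_right 0. norm (h *\<^sub>R f h) \<le> C * h ^ Suc k" using assms by (auto simp: hO_def)
  then have "\<forall>\<^sub>F h in at_right 0. norm (f h) \<le> C * h ^ k"
    using eventually_small[of 1, simplified] by eventually_elim (auto simp: mult.left_commute)
  then show ?thesis by (auto simp: hO_def)
qed

lemma hO_bounded_linear:
  assumes "bounded_linear L" "hO k f" shows "hO k (\<lambda>h. L (f h))"
proof -
  obtain K where K: "K > 0" "\<And>x. norm (L x) \<le> norm x * K"
    using bounded_linear.pos_bounded[OF assms(1)] by blast
  obtain C where C: "\<forall>\<^sub>F h in at_right 0. norm (f h) \<le> C * h ^ k" using assms by (auto simp: hO_def)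
  then have "\<forall>\<^sub>F h in at_right 0. norm (L (f h)) \<le> (C * K) * h ^ k"
  proof eventually_elim
    case (elim h)
    have "norm (L (f h)) \<le> norm (f h) * K" by (rule K)
    also have "\<dots> \<le> C * h ^ k * K" using elim K(1) by (intro mult_right_mono) auto
    finally show ?case by (simp add: mult_ac)
  qed
  then show ?thesis by (auto simp: hO_def)
qed

lemma hO_vec_iff:
  fixes f :: "real \<Rightarrow> real ^ 'n::finite"
  shows "hO k f \<longleftrightarrow> (\<forall>i. hO k (\<lambda>h. f h $ i))"
proof
  assume "hO k f" then show "\<forall>i. hO k (\<lambda>h. f h $ i)"
    by (auto intro: hO_bounded_linear[OF bounded_linear_vec_nth])
next
  assume "\<forall>i. hO k (\<lambda>h. f h $ i)"
  then have "hO k (\<lambda>h. \<Sum>i\<in>UNIV. \<bar>f h $ i\<bar>)"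
    by (intro hO_sum) (simp add: hO_def)
  then show "hO k f" by (rule hO_le[rotated]) (auto intro!: always_eventually norm_le_l1_cart sum_nonneg)
qed

lemma hO_Suc_tendsto_0:
  assumes "hO (Suc k) f" shows "(f \<longlongrightarrow> 0) (at_right 0)"
proof -
  obtain C where C: "\<forall>\<^sub>F h in at_right 0. norm (f h) \<le> C * h ^ 1"
    using hO_mono[OF assms, of 1] by (auto simp: hO_def)
  have "((\<lambda>h::real. C * h ^ 1) \<longlongrightarrow> C * 0 ^ 1) (at_right 0)" by (intro tendsto_intros)
  then show ?thesis using C by (intro Lim_null_comparison[of f "\<lambda>h. C * h ^ 1"]) auto
qed

lemma hO_tendsto:
  assumes "(f \<longlongrightarrow> l) (at_right 0)" shows "hO 0 f"
proof -
  have "\<forall>\<^sub>F h in at_right 0. dist (f h) l < 1" using assms by (rule tendstoD) simp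
  then have "\<forall>\<^sub>F h in at_right 0. norm (f h) \<le> (norm l + 1) * h ^ 0"
    by eventually_elim (simp, norm)
  then show ?thesis by (auto simp: hO_def)
qed

text \<open>A constant that tends to 0 is 0. In this way asymptotic hypotheses give exact
  identities: the two Runge-Kutta order conditions and, from the condition on the denominators,
  \<open>\<rho> y y = y\<close>.\<close>

lemma hO_const_Suc:
  assumes "hO (Suc k) (\<lambda>h. c)" shows "c = 0"
  using hO_Suc_tendsto_0[OF assms] tendsto_unique[OF trivial_limit_at_right_real tendsto_const, of c 0 0] by auto

text \<open>For changes of the step size. The limit of \<open>\<phi>\<close> places
  \<open>\<phi> h\<close> where the bound for \<open>f\<close> holds, and \<open>hO 1 \<phi>\<close>
  turns \<open>\<phi> h ^ k\<close> back into at most a multiple of \<open>h ^ k\<close>.\<close>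

lemma hO_compose:
  assumes "hO k f" "filterlim \<phi> (at_right 0) (at_right 0)" "hO 1 \<phi>"
  shows "hO k (\<lambda>h. f (\<phi> h))"
proof -
  obtain C where C: "C \<ge> 0" "\<forall>\<^sub>F h in at_right 0. norm (f h) \<le> C * h ^ k"
    using hO_nonneg_const[OF assms(1)] by auto
  obtain D where D: "D \<ge> 0" "\<forall>\<^sub>F h in at_right 0. norm (\<phi> h) \<le> D * h ^ 1"
    using hO_nonneg_const[OF assms(3)] by auto
  have "\<forall>\<^sub>F h in at_right 0. norm (f (\<phi> h)) \<le> C * \<phi> h ^ k"
    using assms(2) C(2) unfolding filterlim_iff by blast
  moreover have "\<forall>\<^sub>F h in at_right 0. 0 < \<phi> h"
    using assms(2) eventually_at_right_less[of 0] unfolding filterlim_iff by blast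
  ultimately have "\<forall>\<^sub>F h in at_right 0. norm (f (\<phi> h)) \<le> (C * D ^ k) * h ^ k"
    using D(2)
  proof eventually_elim
    case (elim h)
    then have "\<phi> h ^ k \<le> (D * h) ^ k" by (intro power_mono) auto
    then have "C * \<phi> h ^ k \<le> C * (D * h) ^ k" using C(1) by (rule mult_left_mono)
    then show ?case using elim by (simp add: power_mult_distrib mult_ac)
  qed
  then show ?thesis by (auto simp: hO_def)
qed

subsection \<open>Taylor expansions\<close>

lemma Ck_on_const: "Ck_on k (\<lambda>x. c) S"
  by (induction k arbitrary: c) (auto simp: frechet_derivative_const)

text \<open>A bounded linear map is its own derivative at every point, so its directional
  derivatives are constant and \<open>Ck_on_const\<close> covers all further ones.\<close>

lemma Ck_on_bounded_linear:
  assumes "bounded_linear L" shows "Ck_on k L S"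
proof (cases k)
  case 0
  then show ?thesis using assms by (simp add: linear_continuous_on)
next
  case (Suc j)
  have "frechet_derivative L (at x) = L" for x
    using frechet_derivative_at[OF bounded_linear_imp_has_derivative[OF assms]] by simp
  then show ?thesis using Suc assms by (auto simp: Ck_on_const intro: bounded_linear_imp_differentiable)
qed

text \<open>Only differentiability of the derivative at the base point is needed: it makes the
  derivative Lipschitz there, and the mean value theorem does the rest.\<close>

lemma Ck_on_taylor:
  fixes f :: "'a::euclidean_space \<Rightarrow> 'b::real_normed_vector"
  assumes f: "Ck_on (Suc (Suc k)) f D" and "open D" "y \<in> D"
  shows "\<exists>f' C e. bounded_linear f' \<and> e > 0 \<and>
    (\<forall>x\<in>ball y e. x \<in> D \<and> norm (f x - f y - f' (x - y)) \<le> C * (norm (x - y))\<^sup>2)"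
proof -
  define f' where "f' = (\<lambda>x. frechet_derivative f (at x))"
  have f': "(f has_derivative f' x) (at x)" if "x \<in> D" for x
    using f that by (auto simp: f'_def frechet_derivative_works)
  have lin: "bounded_linear (f' x)" if "x \<in> D" for x
    using f'[OF that] by (rule has_derivative_bounded_linear)
  have diff: "(\<lambda>x. f' x v) differentiable (at y)" for v
    using f \<open>y \<in> D\<close> by (simp add: f'_def)
  \<comment> \<open>\<open>Ck_on\<close> speaks of one direction \<open>v\<close> at a time, so the
    Lipschitz estimate of the derivative at \<open>y\<close> is first found for each direction. Its
    constant is a norm bound of the derivative \<open>g\<close> of \<open>f' x v\<close> in
    \<open>x\<close>, plus 1 for the remainder.\<close>
  have "\<exists>B d. d > 0 \<and> B \<ge> 0 \<and> (\<forall>x\<in>ball y d. norm (f' x v - f' y v) \<le> B * norm (x - y))" for v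
  proof -
    obtain g where g: "((\<lambda>x. f' x v) has_derivative g) (at y)"
      using diff[of v] by (auto simp: differentiable_def)
    then have bl: "bounded_linear g" by (rule has_derivative_bounded_linear)
    obtain K where K: "K > 0" "\<And>x. norm (g x) \<le> norm x * K"
      using bounded_linear.pos_bounded[OF bl] by blast
    from g obtain d where d: "d > 0" "\<And>x. norm (x - y) < d \<Longrightarrow>
        norm (f' x v - f' y v - g (x - y)) \<le> 1 * norm (x - y)"
      unfolding has_derivative_at_alt by (meson zero_less_one)
    have "norm (f' x v - f' y v) \<le> (K + 1) * norm (x - y)" if "x \<in> ball y d" for x
    proof -
      have "norm (f' x v - f' y v) \<le> norm (f' x v - f' y v - g (x - y)) + norm (g (x - y))"
        by norm
      also have "\<dots> \<le> 1 * norm (x - y) + norm (x - y) * K"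
        using that by (intro add_mono K d) (auto simp: dist_norm norm_minus_commute)
      finally show ?thesis by (simp add: algebra_simps)
    qed
    then show ?thesis using K(1) d(1) by (intro exI[of _ "K + 1"] exI[of _ d]) auto
  qed
  then obtain B d where Bd: "\<And>v. d v > 0" "\<And>v. B v \<ge> 0"
      "\<And>v x. x \<in> ball y (d v) \<Longrightarrow> norm (f' x v - f' y v) \<le> B v * norm (x - y)"
    by metis
  obtain e0 where e0: "e0 > 0" "ball y e0 \<subseteq> D"
    using assms(2,3) openE by blast
  \<comment> \<open>The finitely many basis directions suffice: the least radius serves all of them,
    and the sum of their constants bounds the operator norm.\<close>
  define e where "e = Min (insert e0 (d ` Basis))"
  define C where "C = (\<Sum>v\<in>Basis. B v)"
  have e: "e > 0" "e \<le> e0" "\<And>v. v \<in> Basis \<Longrightarrow> e \<le> d v"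
    using Bd(1) e0(1) by (auto simp: e_def Min_gr_iff simp del: Min_insert intro: Min_le)
  have C0: "C \<ge> 0" unfolding C_def by (intro sum_nonneg Bd)
  have onorm_le: "onorm (f' x - f' y) \<le> C * norm (x - y)" if x: "x \<in> ball y e" for x
  proof (rule onorm_le)
    fix u
    have "x \<in> D" using x e e0 by auto
    interpret L: bounded_linear "\<lambda>u. f' x u - f' y u"
      by (intro bounded_linear_sub lin \<open>x \<in> D\<close> \<open>y \<in> D\<close>)
    have "norm (f' x u - f' y u) = norm (\<Sum>v\<in>Basis. (u \<bullet> v) *\<^sub>R (f' x v - f' y v))"
      using L.sum[of "\<lambda>v. (u \<bullet> v) *\<^sub>R v" Basis] by (simp add: L.scaleR euclidean_representation)
    also have "\<dots> \<le> (\<Sum>v\<in>Basis. norm ((u \<bullet> v) *\<^sub>R (f' x v - f' y v)))"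
      by (rule norm_sum)
    also have "\<dots> \<le> (\<Sum>v\<in>Basis. norm u * (B v * norm (x - y)))"
    proof (rule sum_mono)
      fix v :: 'a assume v: "v \<in> Basis"
      have "norm (f' x v - f' y v) \<le> B v * norm (x - y)"
        using x e(3)[OF v] by (intro Bd(3)) simp
      then show "norm ((u \<bullet> v) *\<^sub>R (f' x v - f' y v)) \<le> norm u * (B v * norm (x - y))"
        using Basis_le_norm[OF v, of u] by (simp add: mult_mono)
    qed
    also have "\<dots> = C * norm (x - y) * norm u"
      by (simp add: C_def sum_distrib_left sum_distrib_right mult_ac)
    finally show "norm ((f' x - f' y) u) \<le> C * norm (x - y) * norm u" by simp
  qed
  have "norm (f x - f y - f' y (x - y)) \<le> C * (norm (x - y))\<^sup>2" if x: "x \<in> ball y e" for x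
  proof -
    \<comment> \<open>On the closed ball through \<open>x\<close> the derivative deviates from
      \<open>f' y\<close> by at most \<open>C * norm (x - y)\<close>, so the mean value inequality
      supplies the second factor \<open>norm (x - y)\<close>.\<close>
    let ?S = "cball y (norm (x - y))"
    have S: "?S \<subseteq> ball y e" using x by (auto simp: dist_norm norm_minus_commute)
    have "norm (f x - f y - f' y (x - y)) \<le> norm (x - y) * (C * norm (x - y))"
    proof (rule differentiable_bound_linearization[where S = ?S])
      show "y + t *\<^sub>R (x - y) \<in> ?S" if "t \<in> {0..1}" for t
        using that by (auto simp: dist_norm intro: mult_left_le_one_le)
      show "(f has_derivative f' z) (at z within ?S)" if "z \<in> ?S" for z
      proof -
        have "z \<in> D" using that S subset_ball[OF e(2), of y] e0(2) by blast
        then show ?thesis by (rule has_derivative_at_withinI[OF f'])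
      qed
      show "onorm (f' z - f' y) \<le> C * norm (x - y)" if "z \<in> ?S" for z
      proof -
        have "norm (z - y) \<le> norm (x - y)" using that by (simp add: dist_norm norm_minus_commute)
        then have "C * norm (z - y) \<le> C * norm (x - y)" using C0 by (rule mult_left_mono)
        moreover have "onorm (f' z - f' y) \<le> C * norm (z - y)" using that S by (intro onorm_le) blast
        ultimately show ?thesis by linarith
      qed
    qed simp
    then show ?thesis by (simp add: power2_eq_square mult_ac)
  qed
  moreover have "x \<in> D" if "x \<in> ball y e" for x using that e e0 by auto
  ultimately show ?thesis using e(1) lin[OF \<open>y \<in> D\<close>]
    by (intro exI[of _ "f' y"] exI[of _ C] exI[of _ e]) simp
qed

text \<open>Mean value inequality on \<open>[0, h]\<close>, where \<open>C * s ^ k\<close> is at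
  most \<open>C * h ^ k\<close>. The bound on \<open>e'\<close> holds for \<open>s > 0\<close> only;
  \<open>e' 0 = 0\<close> covers the left endpoint.\<close>

lemma hO_integrate:
  fixes e :: "real \<Rightarrow> 'a::real_normed_vector"
  assumes "\<delta> > 0" "e 0 = 0"
    and der: "\<And>s. s \<in> {0..<\<delta>} \<Longrightarrow> (e has_vector_derivative e' s) (at s within {0..<\<delta>})"
    and "hO k e'" "e' 0 = 0"
  shows "hO (Suc k) e"
proof -
  obtain C where C: "C \<ge> 0" "\<forall>\<^sub>F h in at_right 0. norm (e' h) \<le> C * h ^ k"
    using hO_nonneg_const[OF assms(4)] by auto
  then obtain b where b: "b > 0" "\<And>s. 0 < s \<Longrightarrow> s < b \<Longrightarrow> norm (e' s) \<le> C * s ^ k"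
    unfolding eventually_at_right_field by auto
  have "norm (e h) \<le> C * h ^ Suc k" if h: "0 < h" "h < min b \<delta>" for h
  proof -
    have "norm (e h - e 0 - (h - 0) *\<^sub>R e' 0) \<le> norm (h - 0) * (C * h ^ k)"
    proof (rule vector_differentiable_bound_linearization[where S = "{0..h}"])
      show "(e has_vector_derivative e' s) (at s within {0..h})" if "s \<in> {0..h}" for s
        using that h by (intro has_vector_derivative_within_subset[OF der]) auto
      show "norm (e' s - e' 0) \<le> C * h ^ k" if "s \<in> {0..h}" for s
      proof (cases "s = 0")
        case False
        then have "norm (e' s) \<le> C * s ^ k" using that h by (intro b) auto
        also have "\<dots> \<le> C * h ^ k" using that C(1) by (intro mult_left_mono power_mono) auto
        finally show ?thesis by (simp add: assms(5))
      qed (use C(1) h assms(5) in auto)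
    qed (use h in \<open>auto simp: closed_segment_eq_real_ivl\<close>)
    then show ?thesis using h by (simp add: assms mult_ac)
  qed
  then show ?thesis unfolding hO_def
    by (intro exI[of _ C] eventually_at_right_0[of "min b \<delta>"]) (use b assms in auto)
qed

lemma hO_taylor:
  assumes "e > 0" "\<forall>x\<in>ball y e. norm (f x - f y - f' (x - y)) \<le> C * (norm (x - y))\<^sup>2"
    and x: "hO 1 (\<lambda>h. x h - y)"
  shows "hO 2 (\<lambda>h. f (x h) - f y - f' (x h - y))"
proof -
  have "((\<lambda>h. x h - y) \<longlongrightarrow> 0) (at_right 0)" using x by (intro hO_Suc_tendsto_0[of 0]) simp
  then have "\<forall>\<^sub>F h in at_right 0. dist (x h - y) 0 < e" using assms(1) by (rule tendstoD)
  then have "\<forall>\<^sub>F h in at_right 0. norm (f (x h) - f y - f' (x h - y)) \<le> norm (C * (norm (x h - y))\<^sup>2)"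
  proof eventually_elim
    case (elim h)
    then have "norm (f (x h) - f y - f' (x h - y)) \<le> C * (norm (x h - y))\<^sup>2"
      by (intro assms(2)[rule_format]) (auto simp: dist_norm norm_minus_commute)
    then show ?case by simp
  qed
  moreover have "hO 1 (\<lambda>h. norm (x h - y))" using x by (simp add: hO_def)
  from hO_mult[OF this this] hO_mult[OF hO_const, of 2 _ C]
  have "hO 2 (\<lambda>h. C * (norm (x h - y))\<^sup>2)"
    by (simp add: power2_eq_square numeral_2_eq_2)
  ultimately show ?thesis by (rule hO_le)
qed

section \<open>Local solutions and their second-order expansion\<close>

lemma local_solution_shift:
  assumes "local_solution f S t y"
  obtains \<delta> where "\<delta> > 0" "\<And>s. s \<in> {0..<\<delta>} \<Longrightarrow> y (t + s) \<in> S"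
    "\<And>s. s \<in> {0..<\<delta>} \<Longrightarrow> ((\<lambda>s. y (t + s)) has_vector_derivative f (y (t + s))) (at s within {0..<\<delta>})"
proof -
  obtain \<delta> where d: "\<delta> > 0" "\<And>s. s \<in> {t..<t+\<delta>} \<Longrightarrow> y s \<in> S"
      "\<And>s. s \<in> {t..<t+\<delta>} \<Longrightarrow> (y has_vector_derivative f (y s)) (at s within {t..<t+\<delta>})"
    using assms by (auto simp: local_solution_def)
  have "((\<lambda>s. y (t + s)) has_vector_derivative f (y (t + s))) (at s within {0..<\<delta>})"
    if "s \<in> {0..<\<delta>}" for s
  proof -
    have img: "(\<lambda>s. t + s) ` {0..<\<delta>} = {t..<t+\<delta>}" by (simp add: add.commute)
    have "((\<lambda>s. t + s) has_vector_derivative 1) (at s within {0..<\<delta>})"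
      by (auto intro!: derivative_eq_intros)
    from vector_diff_chain_within[OF this, of y "f (y (t + s))"] d(3)[of "t + s"] that
    show ?thesis by (simp add: img o_def add.commute[of \<delta>])
  qed
  with d show ?thesis by (intro that[of \<delta>]) auto
qed

text \<open>Continuity keeps the curve in the open set \<open>S\<close> for a short time. Explicit
  solutions may leave the positive vectors later, so the differential equation is asked for only
  while they stay there.\<close>

lemma local_solution_open:
  assumes "open S" "y 0 \<in> S" "continuous_on UNIV y"
    and "\<And>s. y s \<in> S \<Longrightarrow> (y has_vector_derivative f (y s)) (at s)"
  shows "local_solution f S 0 y"
proof -
  have "open (y -` S)" using assms(1,3) by (simp add: open_vimage)
  then obtain \<delta> where "\<delta> > 0" "ball 0 \<delta> \<subseteq> y -` S" using assms(2) openE[of "y -` S" 0] by auto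
  then have d: "y s \<in> S" if "0 \<le> s" "s < \<delta>" for s using that by (auto simp: subset_iff)
  then show ?thesis unfolding local_solution_def
    by (intro exI[of _ \<delta>]) (auto simp: \<open>\<delta> > 0\<close> intro!: has_vector_derivative_at_within assms(4))
qed

text \<open>Bootstrap along the solution: differentiability at the start gives
  \<open>y (t + s) - y t = O(s)\<close>, and inserting the current expansion into the Taylor formula
  of \<open>f\<close> and integrating gains one order each time.\<close>

lemma solution_expansion:
  fixes f :: "'a::real_normed_vector \<Rightarrow> 'a"
  assumes sol: "local_solution f S t y"
    and bl: "bounded_linear f'" and e: "e > 0"
    and tay: "\<forall>x\<in>ball (y t) e. norm (f x - f (y t) - f' (x - y t)) \<le> C * (norm (x - y t))\<^sup>2"
  shows "hO 3 (\<lambda>h. y (t + h) - y t - h *\<^sub>R f (y t) - (h\<^sup>2 / 2) *\<^sub>R f' (f (y t)))"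
proof -
  obtain \<delta> where d: "\<delta> > 0"
    "\<And>s. s \<in> {0..<\<delta>} \<Longrightarrow> ((\<lambda>s. y (t + s)) has_vector_derivative f (y (t + s))) (at s within {0..<\<delta>})"
    using local_solution_shift[OF sol] by metis
  interpret L: bounded_linear f' by (rule bl)
  have "((\<lambda>s. y (t + s)) has_derivative (\<lambda>s. s *\<^sub>R f (y t))) (at 0 within {0..<\<delta>})"
    using d(2)[of 0] d(1) by (simp add: has_vector_derivative_def)
  \<comment> \<open>Tolerance 1 in the definition of the derivative is enough, since only
    boundedness of the difference quotient is wanted.\<close>
  then obtain d' where d': "d' > 0" "\<And>s. s \<in> {0..<\<delta>} \<Longrightarrow> norm s < d' \<Longrightarrow>
     norm (y (t + s) - y t - s *\<^sub>R f (y t)) \<le> 1 * norm s"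
    unfolding has_derivative_within_alt by (auto elim!: allE[of _ 1])
  have y1: "hO 1 (\<lambda>s. y (t + s) - y t)"
  proof -
    have "norm (y (t + s) - y t) \<le> (1 + norm (f (y t))) * s ^ 1" if "0 < s" "s < min \<delta> d'" for s
    proof -
      have "norm (y (t + s) - y t) \<le> norm (y (t + s) - y t - s *\<^sub>R f (y t)) + norm (s *\<^sub>R f (y t))"
        using norm_triangle_ineq[of "y (t + s) - y t - s *\<^sub>R f (y t)" "s *\<^sub>R f (y t)"] by simp
      with d'(2)[of s] that show ?thesis by (simp add: algebra_simps)
    qed
    then show ?thesis unfolding hO_def
      by (intro exI eventually_at_right_0[of "min \<delta> d'"]) (use d d' in auto)
  qed
  have Fx: "hO 2 (\<lambda>s. f (y (t + s)) - f (y t) - f' (y (t + s) - y t))"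
    by (rule hO_taylor[OF e tay y1])
  have F1: "hO 1 (\<lambda>s. f (y (t + s)) - f (y t))"
    using hO_add[OF hO_mono[OF Fx, of 1] hO_bounded_linear[OF bl y1]] by simp
  have y2: "hO 2 (\<lambda>s. y (t + s) - y t - s *\<^sub>R f (y t))" (is "hO 2 ?e")
    unfolding numeral_2_eq_2
    by (rule hO_integrate[where \<delta> = \<delta> and e' = "\<lambda>s. f (y (t + s)) - f (y t)"])
      (use F1 d(1) in \<open>auto intro!: derivative_eq_intros d(2)\<close>)
  have "hO 2 (\<lambda>s. f (y (t + s)) - f (y t) - s *\<^sub>R f' (f (y t)))"
    using hO_add[OF Fx hO_bounded_linear[OF bl y2]] by (simp add: L.diff L.scaleR)
  then have "hO (Suc 2) (\<lambda>h. y (t + h) - y t - h *\<^sub>R f (y t) - (h\<^sup>2 / 2) *\<^sub>R f' (f (y t)))"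
  proof (rule hO_integrate[OF d(1), rotated 2])
    show "((\<lambda>h. y (t + h) - y t - h *\<^sub>R f (y t) - (h\<^sup>2 / 2) *\<^sub>R f' (f (y t))) has_vector_derivative
      f (y (t + s)) - f (y t) - s *\<^sub>R f' (f (y t))) (at s within {0..<\<delta>})" if "s \<in> {0..<\<delta>}" for s
      by (rule derivative_eq_intros d(2)[OF that] refl | simp)+
  qed auto
  then show ?thesis by simp
qed

subsection \<open>Patankar equations\<close>

text \<open>The Patankar sum as a linear operator on the vector \<open>u\<close> of weights. The
  destruction rates are the transposed production rates, so the single matrix \<open>P\<close>
  describes both; the weights \<open>u = 1\<close> give the right-hand side of the system.\<close>

definition patankar_op :: "('n \<Rightarrow> 'n \<Rightarrow> real) \<Rightarrow> real ^ 'n::finite \<Rightarrow> real ^ 'n" where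
  "patankar_op P u = (\<chi> m. \<Sum>\<nu>\<in>UNIV. P m \<nu> * u $ \<nu> - P \<nu> m * u $ m)"

definition vdiv :: "real ^ 'n \<Rightarrow> real ^ 'n \<Rightarrow> real ^ 'n::finite" where
  "vdiv z r = (\<chi> \<nu>. z $ \<nu> / r $ \<nu>)"

lemma vdiv_nth [simp]: "vdiv z r $ \<nu> = z $ \<nu> / r $ \<nu>"
  by (simp add: vdiv_def)

lemma patankar_op_add: "patankar_op P (u + v) = patankar_op P u + patankar_op P v"
  by (simp add: patankar_op_def vec_eq_iff algebra_simps sum.distrib sum_subtractf)

lemma patankar_op_diff: "patankar_op P (u - v) = patankar_op P u - patankar_op P v"
  by (simp add: patankar_op_def vec_eq_iff algebra_simps sum.distrib sum_subtractf)

lemma patankar_op_scaleR: "patankar_op P (c *\<^sub>R u) = c *\<^sub>R patankar_op P u"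
  by (simp add: patankar_op_def vec_eq_iff sum_distrib_left algebra_simps)

lemma patankar_op_scale_rate: "patankar_op (\<lambda>m \<nu>. c * P m \<nu>) u = c *\<^sub>R patankar_op P u"
  by (simp add: patankar_op_def vec_eq_iff sum_distrib_left algebra_simps)

lemma patankar_op_add_rate: "patankar_op (\<lambda>m \<nu>. P m \<nu> + Q m \<nu>) u = patankar_op P u + patankar_op Q u"
  by (simp add: patankar_op_def vec_eq_iff algebra_simps sum.distrib sum_subtractf)

text \<open>Moves the denominators into the rates. A Patankar equation thereby takes the linear form
  treated by the \<open>patankar_op_curve\<close> lemmas.\<close>

lemma patankar_op_vdiv: "patankar_op P (vdiv z r) = patankar_op (\<lambda>m \<nu>. P m \<nu> / r $ \<nu>) z"
  by (simp add: patankar_op_def)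

text \<open>A diagonal rate is produced and destroyed in the same component and cancels. Deleting
  the diagonal makes a rate matrix admissible for \<open>pds\<close>.\<close>

lemma patankar_op_zero_diag: "patankar_op (\<lambda>m \<nu>. if m = \<nu> then 0 else P m \<nu>) = patankar_op P"
proof
  fix u
  have "(\<Sum>\<nu>\<in>UNIV. (if m = \<nu> then 0 else P m \<nu>) * u $ \<nu> - (if \<nu> = m then 0 else P \<nu> m) * u $ m)
     = (\<Sum>\<nu>\<in>UNIV. P m \<nu> * u $ \<nu> - P \<nu> m * u $ m)" for m
    by (rule sum.cong) auto
  then show "patankar_op (\<lambda>m \<nu>. if m = \<nu> then 0 else P m \<nu>) u = patankar_op P u" by (simp add: patankar_op_def)
qed

text \<open>Conservation: what one component gains another one loses.\<close>

lemma sum_patankar_op: "(\<Sum>m\<in>UNIV. patankar_op P u $ m) = 0"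
proof -
  have "(\<Sum>m\<in>UNIV. \<Sum>\<nu>\<in>UNIV. P m \<nu> * u $ \<nu>) = (\<Sum>m\<in>UNIV. \<Sum>\<nu>\<in>UNIV. P \<nu> m * u $ m)"
    by (rule sum.swap)
  then show ?thesis by (simp add: patankar_op_def sum_subtractf)
qed

lemma patankar_op_single:
  assumes "m \<noteq> \<nu>" and P: "P = (\<lambda>i j. if i = m \<and> j = \<nu> then 1 else 0)"
  shows "patankar_op P u $ m = u $ \<nu>" "patankar_op P u $ \<nu> = - u $ \<nu>"
proof -
  have "patankar_op P u $ i = (if i = m then u $ \<nu> else 0) - (if i = \<nu> then u $ \<nu> else 0)" for u i
    using assms(1) by (simp add: P patankar_op_def sum_subtractf if_distrib[of "\<lambda>c. c * _"] cong: if_cong)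
  then show "patankar_op P u $ m = u $ \<nu>" "patankar_op P u $ \<nu> = - u $ \<nu>"
    using assms(1) by (auto simp: vec_eq_iff)
qed

section \<open>Bounds for the Patankar operator and curves of solutions\<close>

lemma norm_patankar_op_le:
  "norm (patankar_op Q z) \<le> (\<Sum>m\<in>UNIV. \<Sum>\<nu>\<in>UNIV. \<bar>Q m \<nu>\<bar> + \<bar>Q \<nu> m\<bar>) * norm z"
proof -
  have "norm (patankar_op Q z) \<le> (\<Sum>m\<in>UNIV. \<bar>patankar_op Q z $ m\<bar>)" by (rule norm_le_l1_cart)
  also have "\<dots> \<le> (\<Sum>m\<in>UNIV. \<Sum>\<nu>\<in>UNIV. (\<bar>Q m \<nu>\<bar> + \<bar>Q \<nu> m\<bar>) * norm z)"
  proof (rule sum_mono)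
    fix m
    have "\<bar>Q m \<nu> * z $ \<nu> - Q \<nu> m * z $ m\<bar> \<le> (\<bar>Q m \<nu>\<bar> + \<bar>Q \<nu> m\<bar>) * norm z" for \<nu>
    proof -
      have "\<bar>Q m \<nu> * z $ \<nu> - Q \<nu> m * z $ m\<bar> \<le> \<bar>Q m \<nu>\<bar> * \<bar>z $ \<nu>\<bar> + \<bar>Q \<nu> m\<bar> * \<bar>z $ m\<bar>"
        by (simp add: abs_mult[symmetric])
      also have "\<dots> \<le> \<bar>Q m \<nu>\<bar> * norm z + \<bar>Q \<nu> m\<bar> * norm z"
        by (intro add_mono mult_left_mono component_le_norm_cart) auto
      finally show ?thesis by (simp add: algebra_simps)
    qed
    then show "\<bar>patankar_op Q z $ m\<bar> \<le> (\<Sum>\<nu>\<in>UNIV. (\<bar>Q m \<nu>\<bar> + \<bar>Q \<nu> m\<bar>) * norm z)"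
      by (simp add: patankar_op_def) (intro order_trans[OF sum_abs] sum_mono)
  qed
  finally show ?thesis by (simp add: sum_distrib_right)
qed

lemma hO_patankar_op:
  assumes "\<And>m \<nu>. hO i (\<lambda>h. P h m \<nu>)" "hO j u"
  shows "hO (i + j) (\<lambda>h. patankar_op (P h) (u h))"
proof -
  have u: "hO j (\<lambda>h. u h $ \<nu>)" for \<nu> using assms(2) by (simp add: hO_vec_iff)
  show ?thesis unfolding hO_vec_iff patankar_op_def
    by (simp, intro allI hO_sum hO_diff hO_mult assms(1) u)
qed

lemma hO_vdiv:
  assumes "\<And>\<nu>. hO 0 (\<lambda>h. 1 / r h $ \<nu>)" "hO j u"
  shows "hO j (\<lambda>h. vdiv (u h) (r h))"
proof -
  have u: "hO j (\<lambda>h. u h $ \<nu>)" for \<nu> using assms(2) by (simp add: hO_vec_iff)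
  show ?thesis using hO_mult[OF u assms(1)] by (simp add: hO_vec_iff)
qed

lemma hO_inverse_nth:
  assumes "(\<sigma> \<longlongrightarrow> s) (at_right 0)" "s \<in> positive_vectors"
  shows "hO 0 (\<lambda>h. 1 / \<sigma> h $ \<nu>)"
proof (rule hO_tendsto)
  show "((\<lambda>h. 1 / \<sigma> h $ \<nu>) \<longlongrightarrow> 1 / s $ \<nu>) (at_right 0)"
    using assms by (intro tendsto_intros) (auto simp: positive_vectors_def dest: less_imp_neq spec[of _ \<nu>])
qed

text \<open>For bounded rates, \<open>h\<close> times the operator is eventually a contraction with
  factor 1/2. Existence, boundedness and uniqueness of the solution curves all rest on this.\<close>

lemma patankar_op_curve_bound:
  assumes "\<And>m \<nu>. hO 0 (\<lambda>h. Q h m \<nu>)"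
  shows "\<forall>\<^sub>F h in at_right 0. 0 < h \<and> (\<forall>z. norm (h *\<^sub>R patankar_op (Q h) z) \<le> norm z / 2)"
proof -
  have Q: "hO 0 (\<lambda>h. \<bar>Q h m \<nu>\<bar>)" for m \<nu> using assms[of m \<nu>] by (simp add: hO_def)
  have "hO 0 (\<lambda>h. \<Sum>m\<in>UNIV. \<Sum>\<nu>\<in>UNIV. \<bar>Q h m \<nu>\<bar> + \<bar>Q h \<nu> m\<bar>)"
    by (intro hO_sum hO_add Q)
  then obtain C where C: "C \<ge> 0" "\<forall>\<^sub>F h in at_right 0.
    norm (\<Sum>m\<in>UNIV. \<Sum>\<nu>\<in>UNIV. \<bar>Q h m \<nu>\<bar> + \<bar>Q h \<nu> m\<bar>) \<le> C * h ^ 0"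
    using hO_nonneg_const by blast
  \<comment> \<open>Below this threshold \<open>h * C\<close> is at most 1/2; the summand 1 keeps
    the denominator positive when \<open>C = 0\<close>.\<close>
  have "0 < 1 / (2 * (C + 1))" using C(1) by simp
  from C(2) eventually_small[OF this] show ?thesis
  proof eventually_elim
    case (elim h)
    have "norm (h *\<^sub>R patankar_op (Q h) z) \<le> norm z / 2" for z
    proof -
      have "norm (patankar_op (Q h) z) \<le> (\<Sum>m\<in>UNIV. \<Sum>\<nu>\<in>UNIV. \<bar>Q h m \<nu>\<bar> + \<bar>Q h \<nu> m\<bar>) * norm z"
        by (rule norm_patankar_op_le)
      also have "\<dots> \<le> C * norm z" using elim by (intro mult_right_mono) auto
      finally have "h * norm (patankar_op (Q h) z) \<le> h * (C * norm z)"
        using elim by (intro mult_left_mono) auto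
      also have "\<dots> = (h * C) * norm z" by simp
      also have "\<dots> \<le> (1 / 2) * norm z"
      proof (rule mult_right_mono)
        have "h * C \<le> h * (C + 1)" using elim by simp
        also have "\<dots> \<le> 1 / 2" using elim C(1) by (simp add: field_simps)
        finally show "h * C \<le> 1 / 2" .
      qed simp
      finally show ?thesis using elim by simp
    qed
    then show ?case using elim by simp
  qed
qed

text \<open>By the contraction estimate, the identity minus \<open>h\<close> times the operator is
  injective, hence surjective in finite dimension.\<close>

lemma patankar_op_curve_exists:
  assumes "\<And>m \<nu>. hO 0 (\<lambda>h. Q h m \<nu>)"
  shows "\<exists>z. \<forall>\<^sub>F h in at_right 0. z h = y + h *\<^sub>R patankar_op (Q h) (z h)"
proof -
  have "\<forall>\<^sub>F h in at_right 0. \<exists>z. z = y + h *\<^sub>R patankar_op (Q h) z"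
    using patankar_op_curve_bound[of Q, OF assms]
  proof eventually_elim
    case (elim h)
    let ?L = "\<lambda>z. z - h *\<^sub>R patankar_op (Q h) z"
    have lin: "linear ?L"
      by (rule linearI) (simp_all add: patankar_op_add patankar_op_scaleR algebra_simps)
    have "inj ?L"
      unfolding linear_injective_0[OF lin]
    proof (intro allI impI)
      fix z assume "?L z = 0"
      then have "norm z \<le> norm z / 2" using elim by (metis eq_iff_diff_eq_0)
      then show "z = 0" by simp
    qed
    then have "surj ?L" by (rule linear_inj_imp_surj[OF lin])
    then obtain z where "y = ?L z" by (rule surjE)
    then have "z = y + h *\<^sub>R patankar_op (Q h) z" by (simp add: algebra_simps)
    then show ?case ..
  qed
  then show ?thesis
    by (intro exI[of _ "\<lambda>h. SOME z. z = y + h *\<^sub>R patankar_op (Q h) z"]) (auto elim!: eventually_mono intro: someI2_ex)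
qed

text \<open>The contraction estimate gives \<open>norm (z h) \<le> 2 * norm y\<close>; with
  \<open>z\<close> bounded, the equation shows that \<open>z h - y\<close> is \<open>h\<close> times
  a bounded term.\<close>

lemma patankar_op_curve_hO:
  assumes "\<And>m \<nu>. hO 0 (\<lambda>h. Q h m \<nu>)"
    and z: "\<forall>\<^sub>F h in at_right 0. z h = y + h *\<^sub>R patankar_op (Q h) (z h)"
  shows "hO 1 (\<lambda>h. z h - y)"
proof -
  have "\<forall>\<^sub>F h in at_right 0. norm (z h) \<le> (2 * norm y) * h ^ 0"
    using patankar_op_curve_bound[of Q, OF assms(1)] z
  proof eventually_elim
    case (elim h)
    have "norm (z h) \<le> norm y + norm (h *\<^sub>R patankar_op (Q h) (z h))"
      using elim(2) norm_triangle_ineq by metis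
    with elim(1) show ?case by (auto dest: spec[of _ "z h"])
  qed
  then have "hO 0 z" unfolding hO_def by blast
  from hO_step[OF hO_patankar_op[of 0 Q, OF assms(1) this]]
  have "hO 1 (\<lambda>h. h *\<^sub>R patankar_op (Q h) (z h))" by simp
  moreover have "\<forall>\<^sub>F h in at_right 0. h *\<^sub>R patankar_op (Q h) (z h) = z h - y"
    using z by eventually_elim (metis add_diff_cancel_left')
  ultimately show ?thesis by (rule hO_cong[rotated])
qed

text \<open>If the operator annihilates \<open>y\<close>, then \<open>z h - y\<close> is its own
  image under the contraction.\<close>

lemma patankar_op_curve_stationary:
  assumes "\<And>m \<nu>. hO 0 (\<lambda>h. Q h m \<nu>)"
    and z: "\<forall>\<^sub>F h in at_right 0. z h = y + h *\<^sub>R patankar_op (Q h) (z h)"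
    and y: "\<And>h. patankar_op (Q h) y = 0"
  shows "\<forall>\<^sub>F h in at_right 0. z h = y"
  using patankar_op_curve_bound[of Q, OF assms(1)] z
proof eventually_elim
  case (elim h)
  have "z h - y = h *\<^sub>R patankar_op (Q h) (z h - y)" unfolding patankar_op_diff y diff_zero using elim(2) by (metis add_diff_cancel_left')
  then have "norm (z h - y) \<le> norm (z h - y) / 2" using elim(1) by metis
  then show ?case by simp
qed

section \<open>Positive limits and quotients close to one\<close>

lemma tendsto_of_hO: "hO 1 (\<lambda>h. f h - l) \<Longrightarrow> (f \<longlongrightarrow> l) (at_right 0)"
  using hO_Suc_tendsto_0[of 0 "\<lambda>h. f h - l"] by (simp add: Lim_null[of f])

lemma open_positive_vectors: "open (positive_vectors :: (real ^ 'n::finite) set)"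
proof -
  have "positive_vectors = (\<Inter>m\<in>UNIV. {y :: real ^ 'n. 0 < y $ m})"
    by (auto simp: positive_vectors_def)
  moreover have "open (\<Inter>m\<in>UNIV. {y :: real ^ 'n. 0 < y $ m})"
    by (intro open_INT ballI open_Collect_less continuous_intros) auto
  ultimately show ?thesis by metis
qed

text \<open>The limit of \<open>\<sigma>\<close> is positive, so the reciprocals of its components
  stay bounded and \<open>z / \<sigma> - 1 = (z - \<sigma>) / \<sigma>\<close> inherits the
  order.\<close>

lemma hO_vdiv_one:
  assumes "(\<sigma> \<longlongrightarrow> s) (at_right 0)" "s \<in> positive_vectors" "hO j (\<lambda>h. z h - \<sigma> h)"
  shows "hO j (\<lambda>h. vdiv (z h) (\<sigma> h) - 1)"
proof -
  have "hO j (\<lambda>h. vdiv (z h - \<sigma> h) (\<sigma> h))"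
    by (intro hO_vdiv assms(3) hO_inverse_nth[OF assms(1,2)])
  moreover have "\<forall>\<^sub>F h in at_right 0. vdiv (z h - \<sigma> h) (\<sigma> h) = vdiv (z h) (\<sigma> h) - 1"
    using topological_tendstoD[OF assms(1) open_positive_vectors assms(2)]
  proof eventually_elim
    case (elim h)
    then have "\<sigma> h $ \<nu> \<noteq> 0" for \<nu> by (auto simp: positive_vectors_def dest: less_imp_neq spec[of _ \<nu>])
    then show ?case by (simp add: vec_eq_iff diff_divide_distrib)
  qed
  ultimately show ?thesis by (rule hO_cong[rotated])
qed

lemma hO_of_vdiv_one:
  assumes "(\<sigma> \<longlongrightarrow> s) (at_right 0)" "s \<in> positive_vectors" "hO j (\<lambda>h. vdiv (z h) (\<sigma> h) - 1)"
  shows "hO j (\<lambda>h. z h - \<sigma> h)"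
proof -
  have "((\<lambda>h. \<sigma> h $ \<nu>) \<longlongrightarrow> s $ \<nu>) (at_right 0)" for \<nu>
    using assms(1) by (intro tendsto_intros)
  then have "hO (0 + j) (\<lambda>h. \<sigma> h $ \<nu> * (vdiv (z h) (\<sigma> h) - 1) $ \<nu>)" for \<nu>
    using assms(3) by (intro hO_mult hO_tendsto) (auto simp: hO_vec_iff)
  then have "hO j (\<lambda>h. \<chi> \<nu>. \<sigma> h $ \<nu> * (vdiv (z h) (\<sigma> h) - 1) $ \<nu>)" by (simp add: hO_vec_iff)
  moreover have "\<forall>\<^sub>F h in at_right 0. (\<chi> \<nu>. \<sigma> h $ \<nu> * (vdiv (z h) (\<sigma> h) - 1) $ \<nu>) = z h - \<sigma> h"
    using topological_tendstoD[OF assms(1) open_positive_vectors assms(2)]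
  proof eventually_elim
    case (elim h)
    then have "\<sigma> h $ \<nu> \<noteq> 0" for \<nu> by (auto simp: positive_vectors_def dest: less_imp_neq spec[of _ \<nu>])
    then show ?case by (simp add: vec_eq_iff algebra_simps)
  qed
  ultimately show ?thesis by (rule hO_cong[rotated])
qed

section \<open>Production-destruction systems and their rates\<close>

lemma pds_transpose: "pds D p d \<Longrightarrow> y \<in> D \<Longrightarrow> d m \<nu> y = p \<nu> m y"
  by (simp add: pds_def)

lemma pds_diag: "pds D p d \<Longrightarrow> y \<in> D \<Longrightarrow> p m m y = 0"
  by (simp add: pds_def)

lemma pds_rhs_eq_patankar_op:
  assumes "pds D p d" "y \<in> D"
  shows "pds_rhs p d y = patankar_op (\<lambda>m \<nu>. p m \<nu> y) 1"
proof -
  have "(\<Sum>\<nu>\<in>UNIV. if m = \<nu> then - (\<Sum>j\<in>UNIV. d m j y) else p m \<nu> y)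
      = (\<Sum>\<nu>\<in>UNIV. p m \<nu> y - p \<nu> m y)" for m
  proof -
    have "(\<Sum>\<nu>\<in>UNIV. if m = \<nu> then - (\<Sum>j\<in>UNIV. d m j y) else p m \<nu> y) =
      (\<Sum>\<nu>\<in>UNIV. p m \<nu> y + (if m = \<nu> then - (\<Sum>j\<in>UNIV. d m j y) else 0))"
      using pds_diag[OF assms] by (intro sum.cong) auto
    also have "\<dots> = (\<Sum>\<nu>\<in>UNIV. p m \<nu> y - p \<nu> m y)"
      by (simp add: sum.distrib sum_subtractf pds_transpose[OF assms])
    finally show ?thesis .
  qed
  then show ?thesis by (simp add: pds_rhs_def pds_part_def patankar_op_def vec_eq_iff)
qed

lemma NB1_eq_pds_rhs: "NB1 p d h y = y + h *\<^sub>R pds_rhs p d y"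
  by (simp add: NB1_def pds_rhs_def)

text \<open>Off the diagonal, \<open>p m \<nu>\<close> is a component of
  \<open>pds_part p d \<nu>\<close> and inherits its Lipschitz constant. On the diagonal that
  component is a sum of destruction rates instead, but there the rate vanishes on
  \<open>D\<close>.\<close>

lemma hO_pds_rate:
  assumes "pds D p d" "y \<in> D" "\<forall>\<^sub>F h in at_right 0. x h \<in> D" "hO k (\<lambda>h. x h - y)"
  shows "hO k (\<lambda>h. p m \<nu> (x h) - p m \<nu> y)"
proof (cases "m = \<nu>")
  case True
  have "\<forall>\<^sub>F h in at_right 0. 0 = p m \<nu> (x h) - p m \<nu> y"
    using assms(3) by eventually_elim (simp add: True pds_diag[OF assms(1)] assms(2))
  then show ?thesis by (rule hO_cong) (rule hO_zero)
next
  case False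
  obtain L where L: "L-lipschitz_on D (pds_part p d \<nu>)"
    using assms(1) unfolding pds_def by metis
  have "\<forall>\<^sub>F h in at_right 0. norm (p m \<nu> (x h) - p m \<nu> y) \<le> norm (L *\<^sub>R (x h - y))"
    using assms(3)
  proof eventually_elim
    case (elim h)
    have "\<bar>p m \<nu> (x h) - p m \<nu> y\<bar> = \<bar>(pds_part p d \<nu> (x h) - pds_part p d \<nu> y) $ m\<bar>"
      using False by (simp add: pds_part_def)
    also have "\<dots> \<le> norm (pds_part p d \<nu> (x h) - pds_part p d \<nu> y)" by (rule component_le_norm_cart)
    also have "\<dots> \<le> L * norm (x h - y)"
      using lipschitz_onD[OF L elim assms(2)] by (simp add: dist_norm)
    finally show ?case using lipschitz_on_nonneg[OF L] by simp
  qed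
  then show ?thesis by (rule hO_le) (use hO_scaleR[OF hO_const assms(4)] in simp)
qed

text \<open>All parts are the same linear functional times fixed vectors, hence smooth and
  Lipschitz. Supplies the system with one linear rate.\<close>

lemma pds_scaled:
  fixes g :: "real ^ 'n::finite \<Rightarrow> real"
  assumes "positive_vectors \<subseteq> D"
    and P: "\<And>m \<nu>. P m \<nu> \<ge> 0" "\<And>m. P m m = 0"
    and g: "bounded_linear g" "\<And>x. x \<in> positive_vectors \<Longrightarrow> g x \<ge> 0"
  shows "pds D (\<lambda>m \<nu> x. P m \<nu> * g x) (\<lambda>m \<nu> x. P \<nu> m * g x)"
proof -
  \<comment> \<open>The rates are constant here, so the evaluation point 0 is arbitrary.\<close>
  define w where "w \<nu> = pds_part (\<lambda>m \<nu> _. P m \<nu>) (\<lambda>m \<nu> _. P \<nu> m) \<nu> 0" for \<nu>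
  have part: "pds_part (\<lambda>m \<nu> x. P m \<nu> * g x) (\<lambda>m \<nu> x. P \<nu> m * g x) \<nu> = (\<lambda>x. g x *\<^sub>R w \<nu>)" for \<nu>
    by (rule ext) (simp add: pds_part_def w_def vec_eq_iff sum_distrib_left sum_negf mult_ac)
  have bl: "bounded_linear (\<lambda>x. g x *\<^sub>R w \<nu>)" for \<nu>
    by (rule bounded_linear_compose[OF bounded_linear_scaleR_left g(1)])
  have "\<exists>L. L-lipschitz_on D (\<lambda>x. g x *\<^sub>R w \<nu>)" for \<nu>
    using bounded_linear.lipschitz_boundE[OF bl] by metis
  then show ?thesis
    using P g(2) by (auto simp: pds_def part Ck_on_bounded_linear[OF bl])
qed

lemma pds_const:
  assumes P: "\<And>m \<nu>. P m \<nu> \<ge> 0" "\<And>m. P m m = 0"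
  shows "pds D (\<lambda>m \<nu> _. P m \<nu>) (\<lambda>m \<nu> _. P \<nu> m)"
proof -
  define w where "w \<nu> = pds_part (\<lambda>m \<nu> _. P m \<nu>) (\<lambda>m \<nu> _. P \<nu> m) \<nu> 0" for \<nu>
  have part: "pds_part (\<lambda>m \<nu> _. P m \<nu>) (\<lambda>m \<nu> _. P \<nu> m) \<nu> = (\<lambda>_. w \<nu>)" for \<nu>
    by (simp add: pds_part_def w_def fun_eq_iff)
  have "0-lipschitz_on D (\<lambda>_. w \<nu>)" for \<nu> by (simp add: lipschitz_on_def)
  then show ?thesis unfolding pds_def part using P by (auto simp: Ck_on_const)
qed

lemma hO_weighted_rate:
  assumes "pds D p d" "y \<in> D" "\<forall>\<^sub>F h in at_right 0. x h \<in> D" "hO 1 (\<lambda>h. x h - y)"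
  shows "hO 0 (\<lambda>h. b * p m \<nu> y + c * p m \<nu> (x h))"
proof -
  have "hO 0 (\<lambda>h. p m \<nu> (x h) - p m \<nu> y)"
    by (rule hO_mono[OF hO_pds_rate[OF assms]]) simp
  from hO_add[OF this hO_const[of "p m \<nu> y"]] have "hO 0 (\<lambda>h. p m \<nu> (x h))" by simp
  then have "hO 0 (\<lambda>h. c * p m \<nu> (x h))" using hO_mult[OF hO_const, of 0] by fastforce
  from hO_add[OF hO_const this] show ?thesis .
qed

section \<open>The scheme as a linear equation for the Patankar operator\<close>

lemma patankar_eq_iff:
  assumes "pds D p d" "\<And>j. j \<in> {1..k} \<Longrightarrow> Y j \<in> D"
  shows "patankar_eq p d h y w k Y r z \<longleftrightarrow>
    z = y + h *\<^sub>R patankar_op (\<lambda>m \<nu>. \<Sum>j=1..k. w j * p m \<nu> (Y j)) (vdiv z r)"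
proof -
  have "(\<Sum>j=1..k. w j * (\<Sum>\<nu>\<in>UNIV. p m \<nu> (Y j) * (z $ \<nu> / r $ \<nu>) - d m \<nu> (Y j) * (z $ m / r $ m)))
    = patankar_op (\<lambda>m \<nu>. \<Sum>j=1..k. w j * p m \<nu> (Y j)) (vdiv z r) $ m" (is "?l = _") for m
  proof -
    have "?l = (\<Sum>j=1..k. \<Sum>\<nu>\<in>UNIV. w j * p m \<nu> (Y j) * (z $ \<nu> / r $ \<nu>) - w j * p \<nu> m (Y j) * (z $ m / r $ m))"
      by (intro sum.cong refl) (simp add: sum_distrib_left pds_transpose[OF assms(1) assms(2)] algebra_simps)
    \<comment> \<open>Exchanging the sums moves the Runge-Kutta weights into the rate
      matrix.\<close>
    also have "\<dots> = (\<Sum>\<nu>\<in>UNIV. \<Sum>j=1..k. w j * p m \<nu> (Y j) * (z $ \<nu> / r $ \<nu>) - w j * p \<nu> m (Y j) * (z $ m / r $ m))"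
      by (rule sum.swap)
    finally show ?thesis by (simp add: patankar_op_def sum_distrib_right sum_subtractf sum_divide_distrib)
  qed
  then show ?thesis by (simp add: patankar_eq_def vec_eq_iff)
qed

lemma mprk_stages_2_iff:
  assumes "pds D p d" "y \<in> D"
  shows "mprk_stages p d 2 a (\<lambda>i y Y. \<rho> y (Y 1)) h y Y \<longleftrightarrow>
    Y 1 = y \<and> Y 2 = y + h *\<^sub>R patankar_op (\<lambda>m \<nu>. a 2 1 * p m \<nu> y) (vdiv (Y 2) (\<rho> y y))"
proof -
  have "{1..2::nat} = {1, 2}" by auto
  moreover have "patankar_eq p d h y (a 1) 0 Y r (Y 1) \<longleftrightarrow> Y 1 = y" for r
    by (auto simp: patankar_eq_def vec_eq_iff)
  moreover have "patankar_eq p d h y (a 2) 1 Y r (Y 2) \<longleftrightarrow>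
      Y 2 = y + h *\<^sub>R patankar_op (\<lambda>m \<nu>. a 2 1 * p m \<nu> y) (vdiv (Y 2) r)" if "Y 1 = y" for r
    using that assms(2) by (subst patankar_eq_iff[OF assms(1)]) auto
  ultimately show ?thesis by (auto simp: mprk_stages_def)
qed

lemma patankar_eq_2_iff:
  assumes "pds D p d" "Y 1 \<in> D" "Y 2 \<in> D"
  shows "patankar_eq p d h y b 2 Y r z \<longleftrightarrow>
    z = y + h *\<^sub>R patankar_op (\<lambda>m \<nu>. b 1 * p m \<nu> (Y 1) + b 2 * p m \<nu> (Y 2)) (vdiv z r)"
proof -
  have "j \<in> {1..2} \<Longrightarrow> Y j \<in> D" for j
    using assms(2,3) by (cases "j = 1"; cases "j = 2") auto
  from patankar_eq_iff[OF assms(1) this] show ?thesis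
    by (simp add: numeral_2_eq_2)
qed

section \<open>Order conditions of explicit two-stage Runge-Kutta methods\<close>

lemma has_order_hO:
  assumes "has_order p \<Phi> f S" "local_solution f S t y" "\<forall>\<^sub>F h in at_right 0. \<Phi> h (y t) (z h)"
  shows "hO (p + 1) (\<lambda>h. z h - y (t + h))"
  using assms unfolding has_order_def hO_iff_bigo by blast

text \<open>Two test equations suffice: \<open>y' = v\<close> has one-step error
  \<open>h * (b 1 + b 2 - 1)\<close> times \<open>v\<close>, and then \<open>y' = y\<close> has the
  error \<open>h^2 * (b 2 * a 2 1 - 1/2)\<close> times \<open>v\<close> up to
  \<open>O(h^3)\<close>.\<close>

lemma rk_2_2_conditions:
  assumes "explicit_tableau 2 a c" and ord: "rk_order TYPE(real ^ 'n::finite) 2 2 a b"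
  shows "b 1 + b 2 = 1" "b 2 * a 2 1 = 1 / 2"
proof -
  have I: "{1..2::nat} = {1, 2}" by auto
  have a0: "a 1 1 = 0" "a 1 2 = 0" "a 2 2 = 0"
    using assms(1) by (auto simp: explicit_tableau_def I)
  define v :: "real ^ 'n" where "v = 1"
  have v: "v \<noteq> 0" by (simp add: v_def vec_eq_iff)
  have step: "rk_step f 2 a b h y (y + h *\<^sub>R (b 1 *\<^sub>R f y + b 2 *\<^sub>R f (y + h *\<^sub>R (a 2 1 *\<^sub>R f y))))"
    for f :: "real ^ 'n \<Rightarrow> real ^ 'n" and h y
    unfolding rk_step_def
    by (rule exI[of _ "\<lambda>i. if i = 1 then y else y + h *\<^sub>R (a 2 1 *\<^sub>R f y)"]) (simp add: I[simplified] a0[simplified])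
  have use: "hO 3 (\<lambda>h. y 0 + h *\<^sub>R (b 1 *\<^sub>R f (y 0) + b 2 *\<^sub>R f (y 0 + h *\<^sub>R (a 2 1 *\<^sub>R f (y 0)))) - y h)"
    if "Ck_on 3 f UNIV" "\<exists>L. L-lipschitz_on UNIV f" "local_solution f UNIV 0 y" for f :: "real ^ 'n \<Rightarrow> real ^ 'n" and y
  proof -
    have "has_order 2 (rk_step f 2 a b) f UNIV"
      using ord that(1,2) by (auto simp: rk_order_def)
    from has_order_hO[OF this that(3) always_eventually, OF allI, OF step] show ?thesis by simp
  qed
  have "local_solution (\<lambda>_. v) UNIV 0 (\<lambda>s. s *\<^sub>R v)"
    unfolding local_solution_def by (auto intro!: exI[of _ 1] derivative_eq_intros)
  moreover have "0-lipschitz_on UNIV (\<lambda>_::real ^ 'n. v)"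
    by (simp add: lipschitz_on_def)
  ultimately have "hO 3 (\<lambda>h. 0 *\<^sub>R v + h *\<^sub>R (b 1 *\<^sub>R v + b 2 *\<^sub>R v) - h *\<^sub>R v)"
    using use[OF Ck_on_const exI] by blast
  then have "hO (Suc 2) (\<lambda>h. h *\<^sub>R ((b 1 + b 2 - 1) *\<^sub>R v))"
    by (simp add: algebra_simps)
  then have "hO 2 (\<lambda>h. ((b 1 + b 2 - 1) *\<^sub>R v))"
    by (rule hO_step_cancel)
  then have "hO (Suc 1) (\<lambda>h. ((b 1 + b 2 - 1) *\<^sub>R v))"
    by (simp add: numeral_2_eq_2)
  from hO_const_Suc[OF this] v show b: "b 1 + b 2 = 1" by simp
  have sol: "local_solution (\<lambda>x. x) UNIV 0 (\<lambda>s. exp s *\<^sub>R v)"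
    unfolding local_solution_def by (auto intro!: exI[of _ 1] derivative_eq_intros)
  have "hO 3 (\<lambda>h. v + h *\<^sub>R (b 1 *\<^sub>R v + b 2 *\<^sub>R (v + h *\<^sub>R (a 2 1 *\<^sub>R v))) - exp h *\<^sub>R v)"
  proof -
    have "1-lipschitz_on UNIV (\<lambda>x::real ^ 'n. x)" by (simp add: lipschitz_on_def)
    from use[OF Ck_on_bounded_linear[OF bounded_linear_ident] exI sol, OF this] show ?thesis by simp
  qed
  \<comment> \<open>The Taylor polynomial of \<open>exp\<close>, read off from the identity as
    right-hand side: it is its own derivative, and the remainder constant is 0.\<close>
  moreover have "hO 3 (\<lambda>h. exp (0 + h) *\<^sub>R v - exp 0 *\<^sub>R v - h *\<^sub>R (exp 0 *\<^sub>R v) - (h\<^sup>2 / 2) *\<^sub>R (exp 0 *\<^sub>R v))"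
    by (rule solution_expansion[OF sol bounded_linear_ident, of 1 0]) auto
  ultimately have "hO 3 (\<lambda>h. (v + h *\<^sub>R (b 1 *\<^sub>R v + b 2 *\<^sub>R (v + h *\<^sub>R (a 2 1 *\<^sub>R v))) - exp h *\<^sub>R v) +
     (exp (0 + h) *\<^sub>R v - exp 0 *\<^sub>R v - h *\<^sub>R (exp 0 *\<^sub>R v) - (h\<^sup>2 / 2) *\<^sub>R (exp 0 *\<^sub>R v)))"
    by (rule hO_add)
  moreover have "(v + h *\<^sub>R (b 1 *\<^sub>R v + b 2 *\<^sub>R (v + h *\<^sub>R (a 2 1 *\<^sub>R v))) - exp h *\<^sub>R v) +
     (exp (0 + h) *\<^sub>R v - exp 0 *\<^sub>R v - h *\<^sub>R (exp 0 *\<^sub>R v) - (h\<^sup>2 / 2) *\<^sub>R (exp 0 *\<^sub>R v))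
    = h *\<^sub>R (h *\<^sub>R ((b 2 * a 2 1 - 1 / 2) *\<^sub>R v))" for h
  proof -
    have "(h * b 1) *\<^sub>R v + (h * b 2) *\<^sub>R v = (h * (b 1 + b 2)) *\<^sub>R v"
      by (simp only: distrib_left scaleR_add_left)
    then have "(h * b 1) *\<^sub>R v + (h * b 2) *\<^sub>R v = h *\<^sub>R v" by (simp only: b mult_1_right)
    then show ?thesis by (simp add: algebra_simps power2_eq_square)
  qed
  ultimately have "hO (Suc (Suc (Suc 0))) (\<lambda>h. h *\<^sub>R (h *\<^sub>R ((b 2 * a 2 1 - 1 / 2) *\<^sub>R v)))" by (simp add: numeral_3_eq_3)
  then have "hO (Suc 0) (\<lambda>h. ((b 2 * a 2 1 - 1 / 2) *\<^sub>R v))" by (rule hO_step_cancel[OF hO_step_cancel])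
  from hO_const_Suc[OF this] v show "b 2 * a 2 1 = 1 / 2" by simp
qed

subsection \<open>Two-stage schemes\<close>

lemma pds_rhs_taylor:
  fixes D :: "(real ^ 'n::finite) set"
  assumes "pds D p d" "open D" "y \<in> D"
  shows "\<exists>F' C e. bounded_linear F' \<and> e > 0 \<and>
    (\<forall>x\<in>ball y e. norm (pds_rhs p d x - pds_rhs p d y - F' (x - y)) \<le> C * (norm (x - y))\<^sup>2)"
proof -
  have "Ck_on (Suc (Suc 1)) (pds_part p d \<nu>) D" for \<nu>
    using assms(1) by (simp add: pds_def numeral_3_eq_3)
  from Ck_on_taylor[OF this assms(2,3)] obtain F' C e where
    F': "\<And>\<nu>. bounded_linear (F' \<nu>)" "\<And>\<nu>. e \<nu> > 0"
     "\<And>\<nu> x. x \<in> ball y (e \<nu>) \<Longrightarrow> norm (pds_part p d \<nu> x - pds_part p d \<nu> y - F' \<nu> (x - y)) \<le> C \<nu> * (norm (x - y))\<^sup>2"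
    by metis
  define e0 where "e0 = Min (range e)"
  have e0: "e0 > 0" "\<And>\<nu>. e0 \<le> e \<nu>" using F'(2) by (auto simp: e0_def)
  have "norm (pds_rhs p d x - pds_rhs p d y - (\<Sum>\<nu>\<in>UNIV. F' \<nu> (x - y))) \<le> (\<Sum>\<nu>\<in>UNIV. C \<nu>) * (norm (x - y))\<^sup>2"
    if "x \<in> ball y e0" for x
  proof -
    have "norm (pds_part p d \<nu> x - pds_part p d \<nu> y - F' \<nu> (x - y)) \<le> C \<nu> * (norm (x - y))\<^sup>2" for \<nu>
      using that e0(2)[of \<nu>] by (intro F'(3)) simp
    then have "norm (\<Sum>\<nu>\<in>UNIV. pds_part p d \<nu> x - pds_part p d \<nu> y - F' \<nu> (x - y)) \<le> (\<Sum>\<nu>\<in>UNIV. C \<nu> * (norm (x - y))\<^sup>2)"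
      by (intro sum_norm_le) auto
    then show ?thesis by (simp add: pds_rhs_def sum_subtractf sum_distrib_right)
  qed
  moreover have "bounded_linear (\<lambda>x. \<Sum>\<nu>\<in>UNIV. F' \<nu> x)" by (intro bounded_linear_sum F')
  ultimately show ?thesis using e0(1)
    by (intro exI[of _ "\<lambda>x. \<Sum>\<nu>\<in>UNIV. F' \<nu> x"] exI[of _ "\<Sum>\<nu>\<in>UNIV. C \<nu>"] exI[of _ e0]) simp
qed

lemma ex_other_index:
  assumes "CARD('n::finite) \<ge> 2" shows "\<exists>m. m \<noteq> (\<nu>::'n)"
proof (rule ccontr)
  assume "\<not> ?thesis"
  then have "UNIV = {\<nu>}" by auto
  then have "CARD('n) = 1" by (metis card_1_singleton_iff One_nat_def)
  with assms show False by simp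
qed

text \<open>The Runge-Kutta method is represented by its order conditions \<open>b_sum\<close> and
  \<open>b_a\<close>. The open set \<open>D\<close> lets the stages be handled by limits: they are
  eventually in \<open>D\<close> because they tend to a positive vector.\<close>

locale mprk_2 =
  fixes a :: "nat \<Rightarrow> nat \<Rightarrow> real" and b :: "nat \<Rightarrow> real"
    and \<rho> :: "real ^ 'n::finite \<Rightarrow> real ^ 'n \<Rightarrow> real ^ 'n"
    and \<sigma> :: "real ^ 'n \<Rightarrow> real ^ 'n \<Rightarrow> real ^ 'n \<Rightarrow> real ^ 'n"
    and D :: "(real ^ 'n) set"
  assumes open_D: "open D" and pos_D: "positive_vectors \<subseteq> D"
    and a_nonneg: "a 2 1 \<ge> 0"
    and b_sum: "b 1 + b 2 = 1" and b_a: "b 2 * a 2 1 = 1 / 2"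
    and \<sigma>_cont: "continuous_on (positive_vectors \<times> positive_vectors \<times> positive_vectors)
           (\<lambda>(y, y1, y2). \<sigma> y y1 y2)"
    and \<rho>_pos: "\<And>y y1. y \<in> positive_vectors \<Longrightarrow> y1 \<in> positive_vectors \<Longrightarrow> \<rho> y y1 \<in> positive_vectors"
    and \<sigma>_pos: "\<And>y y1 y2. y \<in> positive_vectors \<Longrightarrow> y1 \<in> positive_vectors \<Longrightarrow> y2 \<in> positive_vectors \<Longrightarrow>
           \<sigma> y y1 y2 \<in> positive_vectors"
begin

abbreviation "stages p d \<equiv> mprk_stages p d 2 a (\<lambda>i y Y. \<rho> y (Y 1))"
abbreviation "step p d \<equiv> mprk_step p d 2 a b (\<lambda>i y Y. \<rho> y (Y 1)) (\<lambda>y Y. \<sigma> y (Y 1) (Y 2))"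

text \<open>The second stage as a curve in the step size. It depends on the system through the rates
  \<open>P\<close> at \<open>y\<close> alone, so systems with equal rates at \<open>y\<close> share
  their stage curves.\<close>

definition stage_curve :: "('n \<Rightarrow> 'n \<Rightarrow> real) \<Rightarrow> real ^ 'n \<Rightarrow> (real \<Rightarrow> real ^ 'n) \<Rightarrow> bool" where
  "stage_curve P y x \<longleftrightarrow>
    (\<forall>\<^sub>F h in at_right 0. x h = y + h *\<^sub>R patankar_op (\<lambda>m \<nu>. a 2 1 * P m \<nu>) (vdiv (x h) (\<rho> y y)))"

lemma stage_curve_exists: "\<exists>x. stage_curve P y x"
  unfolding stage_curve_def patankar_op_vdiv by (intro patankar_op_curve_exists hO_const)

lemma stage_curve_hO: "stage_curve P y x \<Longrightarrow> hO 1 (\<lambda>h. x h - y)"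
  unfolding stage_curve_def patankar_op_vdiv by (intro patankar_op_curve_hO[OF hO_const])

lemma stage_curve_tendsto: "stage_curve P y x \<Longrightarrow> (x \<longlongrightarrow> y) (at_right 0)"
  by (rule tendsto_of_hO[OF stage_curve_hO])

lemma stage_curve_of_stages:
  assumes "pds D p d" "y \<in> positive_vectors"
    "\<forall>\<^sub>F h in at_right 0. stages p d h y (Y h)"
  shows "stage_curve (\<lambda>m \<nu>. p m \<nu> y) y (\<lambda>h. Y h 2)" "\<forall>\<^sub>F h in at_right 0. Y h 1 = y"
  using assms(3) mprk_stages_2_iff[OF assms(1), of y] assms(2) pos_D
  unfolding stage_curve_def by (auto elim!: eventually_mono)

section \<open>Sufficiency of the conditions on the denominators\<close>

lemma order_two_of_denominators:
  assumes pds: "pds D p d"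
    and den: "\<And>y Y. y \<in> positive_vectors \<Longrightarrow> \<forall>\<^sub>F h in at_right 0. stages p d h y (Y h) \<Longrightarrow>
      \<rho> y y = y \<and> hO 2 (\<lambda>h. \<sigma> y y (Y h 2) - NB1 p d h y)"
  shows "has_order 2 (step p d) (pds_rhs p d) positive_vectors"
  unfolding has_order_def hO_iff_bigo[symmetric]
proof (intro allI impI, elim conjE)
  fix t y z assume sol: "local_solution (pds_rhs p d) positive_vectors t y"
    and step: "\<forall>\<^sub>F h in at_right 0. step p d h (y t) (z h)"
  define y0 where "y0 = y t"
  have y0: "y0 \<in> positive_vectors" "y0 \<in> D"
    using sol pos_D by (auto simp: y0_def local_solution_def)
  \<comment> \<open>A step provides its stages separately for each \<open>h\<close>; choosing them
    yields one curve of stages to which \<open>den\<close> applies.\<close>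
  define Y where "Y h = (SOME Y. stages p d h y0 Y \<and> patankar_eq p d h y0 b 2 Y (\<sigma> y0 (Y 1) (Y 2)) (z h))" for h
  have Y: "\<forall>\<^sub>F h in at_right 0. stages p d h y0 (Y h) \<and> patankar_eq p d h y0 b 2 (Y h) (\<sigma> y0 (Y h 1) (Y h 2)) (z h)"
    using step
  proof eventually_elim
    case (elim h)
    then show ?case unfolding Y_def y0_def[symmetric] mprk_step_def by (rule someI_ex)
  qed
  then have st: "\<forall>\<^sub>F h in at_right 0. stages p d h y0 (Y h)" by (auto elim: eventually_mono)
  define x where "x h = Y h 2" for h
  define P where "P m \<nu> = p m \<nu> y0" for m \<nu>
  define F where "F = pds_rhs p d"
  define s where "s h = \<sigma> y0 y0 (x h)" for h
  define Px where "Px h m \<nu> = b 1 * P m \<nu> + b 2 * p m \<nu> (x h)" for h m \<nu>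
  have \<rho>: "\<rho> y0 y0 = y0" and s2: "hO 2 (\<lambda>h. s h - (y0 + h *\<^sub>R F y0))"
    using den[OF y0(1) st] by (auto simp: s_def x_def NB1_eq_pds_rhs F_def)
  have cx: "stage_curve P y0 x" and Y1: "\<forall>\<^sub>F h in at_right 0. Y h 1 = y0"
    using stage_curve_of_stages[OF pds y0(1) st] by (auto simp: P_def[abs_def] x_def[abs_def])
  have x1: "hO 1 (\<lambda>h. x h - y0)" by (rule stage_curve_hO[OF cx])
  have xD: "\<forall>\<^sub>F h in at_right 0. x h \<in> D"
    using topological_tendstoD[OF stage_curve_tendsto[OF cx] open_D y0(2)] .
  have F0: "F y0 = patankar_op P 1" by (simp add: F_def pds_rhs_eq_patankar_op[OF pds y0(2)] P_def[abs_def])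
  \<comment> \<open>Because \<open>\<rho> y0 y0 = y0\<close>, the weights of the second stage are
    \<open>1 + O(h)\<close>. The stage therefore agrees with the explicit Euler step of length
    \<open>h * a 2 1\<close> up to second order.\<close>
  have x2: "hO 2 (\<lambda>h. x h - y0 - (h * a 2 1) *\<^sub>R F y0)"
  proof -
    have "hO 1 (\<lambda>h. vdiv (x h) y0 - 1)" by (rule hO_vdiv_one[OF tendsto_const y0(1) x1])
    from hO_step[OF hO_patankar_op[OF hO_const this, of "\<lambda>m \<nu>. a 2 1 * P m \<nu>"]]
    have "hO 2 (\<lambda>h. h *\<^sub>R patankar_op (\<lambda>m \<nu>. a 2 1 * P m \<nu>) (vdiv (x h) y0 - 1))" by (simp add: numeral_2_eq_2)
    moreover have "\<forall>\<^sub>F h in at_right 0. h *\<^sub>R patankar_op (\<lambda>m \<nu>. a 2 1 * P m \<nu>) (vdiv (x h) y0 - 1)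
      = x h - y0 - (h * a 2 1) *\<^sub>R F y0"
      using cx[unfolded stage_curve_def \<rho>]
    proof eventually_elim
      case (elim h)
      have "x h - y0 = h *\<^sub>R (a 2 1 *\<^sub>R patankar_op P (vdiv (x h) y0))"
        by (subst elim) (simp add: patankar_op_scale_rate)
      then show ?case by (simp add: patankar_op_diff patankar_op_scale_rate F0 scaleR_diff_right)
    qed
    ultimately show ?thesis by (rule hO_cong[rotated])
  qed
  have hF: "hO 1 (\<lambda>h. h *\<^sub>R v)" for v :: "real ^ 'n" using hO_step[OF hO_const, of v] by simp
  have s1: "hO 1 (\<lambda>h. s h - y0)"
    using hO_add[OF hO_mono[OF s2, of 1] hF[of "F y0"]] by simp
  have slim: "(s \<longlongrightarrow> y0) (at_right 0)" by (rule tendsto_of_hO[OF s1])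
  have Px: "hO 0 (\<lambda>h. Px h m \<nu>)" for m \<nu>
    unfolding Px_def P_def by (rule hO_weighted_rate[OF pds y0(2) xD x1])
  have zeq: "\<forall>\<^sub>F h in at_right 0. z h = y0 + h *\<^sub>R patankar_op (Px h) (vdiv (z h) (s h))"
    using Y Y1 xD
  proof eventually_elim
    case (elim h)
    then show ?case using patankar_eq_2_iff[OF pds, of "Y h"] y0(2)
      by (auto simp: x_def s_def Px_def[abs_def] P_def)
  qed
  have z1: "hO 1 (\<lambda>h. z h - y0)"
  proof (rule patankar_op_curve_hO)
    have "hO 0 (\<lambda>h. 1 / s h $ \<nu>)" for \<nu> by (rule hO_inverse_nth[OF slim y0(1)])
    from hO_mult[OF Px this] show "hO 0 (\<lambda>h. Px h m \<nu> / s h $ \<nu>)" for m \<nu> by simp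
    show "\<forall>\<^sub>F h in at_right 0. z h = y0 + h *\<^sub>R patankar_op (\<lambda>m \<nu>. Px h m \<nu> / s h $ \<nu>) (z h)"
      using zeq by (simp only: patankar_op_vdiv)
  qed
  define w where "w h = vdiv (z h) (s h) - 1" for h
  \<comment> \<open>The contribution of the weights differing from 1. It is one order smaller than
    \<open>z - s\<close>, which drives the bootstrap.\<close>
  define E where "E h = h *\<^sub>R patankar_op (Px h) (w h)" for h
  have E: "hO (Suc j) E" if "hO j (\<lambda>h. z h - s h)" for j
    using hO_step[OF hO_patankar_op[OF Px hO_vdiv_one[OF slim y0(1) that]]] by (simp add: E_def[abs_def] w_def)
  have zE: "\<forall>\<^sub>F h in at_right 0. z h = y0 + h *\<^sub>R F y0 + (h * b 2) *\<^sub>R (F (x h) - F y0) + E h"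
    using zeq xD
  proof eventually_elim
    case (elim h)
    have "z h - y0 = h *\<^sub>R patankar_op (Px h) (vdiv (z h) (s h))" by (subst elim(1)) simp
    also have "\<dots> = h *\<^sub>R patankar_op (Px h) 1 + E h"
      by (simp add: E_def w_def patankar_op_diff algebra_simps)
    also have "patankar_op (Px h) 1 = b 1 *\<^sub>R F y0 + b 2 *\<^sub>R F (x h)"
      unfolding Px_def patankar_op_add_rate patankar_op_scale_rate F0
      by (simp add: F_def pds_rhs_eq_patankar_op[OF pds elim(2)])
    also have "\<dots> = F y0 + b 2 *\<^sub>R (F (x h) - F y0)"
      using b_sum by (simp add: algebra_simps flip: scaleR_add_left)
    finally show ?case by (simp add: algebra_simps)
  qed
  obtain F' C e where F': "bounded_linear F'" "e > 0"
    "\<forall>x\<in>ball y0 e. norm (F x - F y0 - F' (x - y0)) \<le> C * (norm (x - y0))\<^sup>2"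
    using pds_rhs_taylor[OF pds open_D y0(2)] unfolding F_def by blast
  interpret F': bounded_linear F' by (rule F'(1))
  have tx: "hO 2 (\<lambda>h. F (x h) - F y0 - F' (x h - y0))"
    by (rule hO_taylor[OF F'(2,3) x1])
  have Fx1: "hO 1 (\<lambda>h. F (x h) - F y0)"
    using hO_add[OF hO_mono[OF tx, of 1] hO_bounded_linear[OF F'(1) x1]] by simp
  have Fx2: "hO 2 (\<lambda>h. F (x h) - F y0 - (h * a 2 1) *\<^sub>R F' (F y0))"
  proof -
    have "hO 2 (\<lambda>h. (F (x h) - F y0 - F' (x h - y0)) + F' (x h - y0 - (h * a 2 1) *\<^sub>R F y0))"
      by (intro hO_add tx hO_bounded_linear[OF F'(1) x2])
    moreover have "(F (x h) - F y0 - F' (x h - y0)) + F' (x h - y0 - (h * a 2 1) *\<^sub>R F y0)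
      = F (x h) - F y0 - (h * a 2 1) *\<^sub>R F' (F y0)" for h
      by (simp add: F'.diff F'.scaleR)
    ultimately show ?thesis by (simp only:)
  qed
  \<comment> \<open>First round: \<open>z\<close> and \<open>s\<close> both equal
    \<open>y0 + O(h)\<close>, so \<open>E\<close> is \<open>O(h^2)\<close> and \<open>z\<close> is
    known to second order.\<close>
  have z2: "hO 2 (\<lambda>h. z h - y0 - h *\<^sub>R F y0)"
  proof (rule hO_cong)
    have "hO 1 (\<lambda>h. z h - s h)" using hO_diff[OF z1 s1] by simp
    then have "hO 2 E" using E[of 1] by (simp add: numeral_2_eq_2)
    moreover have "hO 2 (\<lambda>h. h *\<^sub>R (b 2 *\<^sub>R (F (x h) - F y0)))"
      using hO_step[OF hO_scaleR[OF hO_const Fx1], of "b 2"] by (simp add: numeral_2_eq_2)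
    ultimately show "hO 2 (\<lambda>h. h *\<^sub>R (b 2 *\<^sub>R (F (x h) - F y0)) + E h)" by (intro hO_add)
    show "\<forall>\<^sub>F h in at_right 0. h *\<^sub>R (b 2 *\<^sub>R (F (x h) - F y0)) + E h = z h - y0 - h *\<^sub>R F y0"
      using zE by eventually_elim simp
  qed
  \<comment> \<open>Second round: \<open>z\<close> and \<open>s\<close> now share the expansion
    \<open>y0 + h F(y0)\<close>, so \<open>E\<close> is \<open>O(h^3)\<close>, and
    \<open>b 2 * a 2 1 = 1/2\<close> produces the quadratic Taylor term.\<close>
  have z3: "hO 3 (\<lambda>h. z h - y0 - h *\<^sub>R F y0 - (h\<^sup>2 / 2) *\<^sub>R F' (F y0))"
  proof (rule hO_cong)
    have "hO 2 (\<lambda>h. z h - s h)" using hO_diff[OF z2 s2] by (simp add: algebra_simps)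
    then have "hO 3 E" using E[of 2] by (simp add: numeral_3_eq_3)
    moreover have "hO 3 (\<lambda>h. h *\<^sub>R (b 2 *\<^sub>R (F (x h) - F y0 - (h * a 2 1) *\<^sub>R F' (F y0))))"
      using hO_step[OF hO_scaleR[OF hO_const Fx2], of "b 2"] by (simp add: numeral_3_eq_3)
    ultimately show "hO 3 (\<lambda>h. h *\<^sub>R (b 2 *\<^sub>R (F (x h) - F y0 - (h * a 2 1) *\<^sub>R F' (F y0))) + E h)" by (intro hO_add)
    have ba: "h * (b 2 * (h * a 2 1)) = h\<^sup>2 / 2" for h
      using b_a by (simp add: power2_eq_square mult.left_commute)
    show "\<forall>\<^sub>F h in at_right 0. h *\<^sub>R (b 2 *\<^sub>R (F (x h) - F y0 - (h * a 2 1) *\<^sub>R F' (F y0))) + E h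
        = z h - y0 - h *\<^sub>R F y0 - (h\<^sup>2 / 2) *\<^sub>R F' (F y0)"
      using zE by eventually_elim (simp add: scaleR_diff_right ba[simplified])
  qed
  have "hO 3 (\<lambda>h. y (t + h) - y0 - h *\<^sub>R F y0 - (h\<^sup>2 / 2) *\<^sub>R F' (F y0))"
    using solution_expansion[OF sol F'(1,2), of C] F'(3) unfolding F_def y0_def by blast
  from hO_diff[OF z3 this] show "hO (2 + 1) (\<lambda>h. z h - y (t + h))" by simp
qed

section \<open>Necessity of the conditions on the denominators\<close>

lemma \<sigma>_tendsto:
  assumes "y \<in> positive_vectors" "(x \<longlongrightarrow> y) (at_right 0)"
  shows "((\<lambda>h. \<sigma> y y (x h)) \<longlongrightarrow> \<sigma> y y y) (at_right 0)"
proof -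
  have "\<forall>\<^sub>F h in at_right 0. x h \<in> positive_vectors"
    using topological_tendstoD[OF assms(2) open_positive_vectors assms(1)] .
  then have "\<forall>\<^sub>F h in at_right 0. (y, y, x h) \<in> positive_vectors \<times> positive_vectors \<times> positive_vectors"
    by eventually_elim (simp add: assms(1))
  moreover have "((\<lambda>h. (y, y, x h)) \<longlongrightarrow> (y, y, y)) (at_right 0)"
    by (intro tendsto_intros assms)
  ultimately show ?thesis
    using continuous_on_tendsto_compose[OF \<sigma>_cont, of "\<lambda>h. (y, y, x h)" "(y, y, y)"] assms(1) by simp
qed

lemma inverse_\<sigma>_hO:
  assumes y: "y \<in> positive_vectors" and x: "stage_curve P y x"
  shows "hO 0 (\<lambda>h. 1 / \<sigma> y y (x h) $ \<nu>)"
  by (rule hO_inverse_nth[OF \<sigma>_tendsto[OF y stage_curve_tendsto[OF x]] \<sigma>_pos[OF y y y]])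

context
  assumes order: "\<And>p d. pds D p d \<Longrightarrow> has_order 2 (step p d) (pds_rhs p d) positive_vectors"
begin

text \<open>Order two speaks of given update curves only. Here an update curve is constructed for a
  prescribed stage curve by solving the linear equation for small \<open>h\<close>, so that the
  order hypothesis can be applied to it.\<close>

lemma order_two_expansion:
  assumes pds: "pds D p d" and y: "y \<in> positive_vectors"
    and sol: "local_solution (pds_rhs p d) positive_vectors 0 s" "s 0 = y"
    and x: "stage_curve (\<lambda>m \<nu>. p m \<nu> y) y x"
  obtains z where "\<forall>\<^sub>F h in at_right 0. z h = y + h *\<^sub>R patankar_op (\<lambda>m \<nu>. b 1 * p m \<nu> y + b 2 * p m \<nu> (x h)) (vdiv (z h) (\<sigma> y y (x h)))"
    "hO 3 (\<lambda>h. z h - s h)"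
proof -
  have yD: "y \<in> D" using y pos_D by auto
  have xD: "\<forall>\<^sub>F h in at_right 0. x h \<in> D"
    using topological_tendstoD[OF stage_curve_tendsto[OF x] open_D yD] .
  define Px where "Px h m \<nu> = b 1 * p m \<nu> y + b 2 * p m \<nu> (x h)" for h m \<nu>
  have Px: "hO 0 (\<lambda>h. Px h m \<nu>)" for m \<nu>
    unfolding Px_def by (rule hO_weighted_rate[OF pds yD xD stage_curve_hO[OF x]])
  have Q: "hO 0 (\<lambda>h. Px h m \<nu> / \<sigma> y y (x h) $ \<nu>)" for m \<nu>
    using hO_mult[OF Px inverse_\<sigma>_hO[OF y x]] by simp
  obtain z where z: "\<forall>\<^sub>F h in at_right 0. z h = y + h *\<^sub>R patankar_op (Px h) (vdiv (z h) (\<sigma> y y (x h)))"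
    unfolding patankar_op_vdiv using patankar_op_curve_exists[of "\<lambda>h m \<nu>. Px h m \<nu> / \<sigma> y y (x h) $ \<nu>", OF Q] ..
  have "\<forall>\<^sub>F h in at_right 0. step p d h (s 0) (z h)"
    using z xD x[unfolded stage_curve_def]
  proof eventually_elim
    case (elim h)
    define Y where "Y i = (if i = 1 then y else x h)" for i :: nat
    have Y: "Y 1 = y" "Y 2 = x h" by (simp_all add: Y_def)
    have YD: "Y 1 \<in> D" "Y 2 \<in> D" using yD elim(2) by (simp_all only: Y)
    have "stages p d h y Y" unfolding mprk_stages_2_iff[OF pds yD] Y by (intro conjI refl elim(3))
    moreover have "patankar_eq p d h y b 2 Y (\<sigma> y (Y 1) (Y 2)) (z h)"
      unfolding patankar_eq_2_iff[OF pds YD] Y by (rule elim(1)[unfolded Px_def[abs_def]])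
    ultimately show ?case unfolding mprk_step_def sol(2) by blast
  qed
  from has_order_hO[OF order[OF pds] sol(1) this] have "hO 3 (\<lambda>h. z h - s h)" by simp
  with z show ?thesis unfolding Px_def by (rule that)
qed

text \<open>The exact solution is a straight line, and \<open>b 1 + b 2 = 1\<close> reduces the
  update rates to \<open>P\<close>. The error of \<open>z\<close> is then \<open>h\<close> times the
  operator at the weights minus 1; after division by \<open>h\<close>, replacing \<open>z\<close> by
  the exact solution in the weights costs only \<open>O(h^3)\<close>.\<close>

lemma const_rates:
  assumes P: "\<And>m \<nu>. P m \<nu> \<ge> 0" "\<And>m. P m m = 0" and y: "y \<in> positive_vectors" and x: "stage_curve P y x"
  shows "hO 2 (\<lambda>h. patankar_op P (vdiv (y + h *\<^sub>R patankar_op P 1) (\<sigma> y y (x h)) - 1))"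
proof -
  let ?p = "\<lambda>m \<nu> (_ :: real ^ 'n). P m \<nu>" and ?d = "\<lambda>m \<nu> (_ :: real ^ 'n). P \<nu> m"
  let ?v = "patankar_op P 1"
  have pds: "pds D ?p ?d" by (rule pds_const[OF P])
  then have rhs: "pds_rhs ?p ?d u = ?v" for u
  proof -
    have "pds_rhs ?p ?d u = pds_rhs ?p ?d y" by (simp add: pds_rhs_def pds_part_def)
    then show ?thesis using pds_rhs_eq_patankar_op[OF pds, of y] y pos_D by auto
  qed
  have "local_solution (pds_rhs ?p ?d) positive_vectors 0 (\<lambda>h. y + h *\<^sub>R ?v)"
    by (rule local_solution_open[OF open_positive_vectors])
      (auto simp: y rhs intro!: derivative_eq_intros continuous_intros)
  from order_two_expansion[OF pds y this _ x] obtain z where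
    z: "\<forall>\<^sub>F h in at_right 0. z h = y + h *\<^sub>R patankar_op (\<lambda>m \<nu>. b 1 * P m \<nu> + b 2 * P m \<nu>) (vdiv (z h) (\<sigma> y y (x h)))"
    and z3: "hO 3 (\<lambda>h. z h - (y + h *\<^sub>R ?v))" by auto
  have rate: "(\<lambda>m \<nu>. b 1 * P m \<nu> + b 2 * P m \<nu>) = P"
    using b_sum by (simp flip: distrib_right)
  have "\<forall>\<^sub>F h in at_right 0. z h - (y + h *\<^sub>R ?v) = h *\<^sub>R patankar_op P (vdiv (z h) (\<sigma> y y (x h)) - 1)"
    using z unfolding rate
  proof eventually_elim
    case (elim h)
    have "z h - y = h *\<^sub>R patankar_op P (vdiv (z h) (\<sigma> y y (x h)))" by (subst elim) simp
    then show ?case by (simp add: patankar_op_diff scaleR_diff_right)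
  qed
  from hO_cong[OF this z3] have "hO (Suc 2) (\<lambda>h. h *\<^sub>R patankar_op P (vdiv (z h) (\<sigma> y y (x h)) - 1))" by simp
  then have 1: "hO 2 (\<lambda>h. patankar_op P (vdiv (z h) (\<sigma> y y (x h)) - 1))" by (rule hO_step_cancel)
  have "hO 0 (\<lambda>h. 1 / \<sigma> y y (x h) $ \<nu>)" for \<nu> by (rule inverse_\<sigma>_hO[OF y x])
  from hO_vdiv[OF this z3] have "hO 2 (\<lambda>h. vdiv (z h - (y + h *\<^sub>R ?v)) (\<sigma> y y (x h)))"
    by (rule hO_mono) simp
  from hO_patankar_op[of 0 "\<lambda>_. P", OF hO_const this]
  have "hO 2 (\<lambda>h. patankar_op P (vdiv (z h - (y + h *\<^sub>R ?v)) (\<sigma> y y (x h))))" by (simp only: add_0)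
  from hO_diff[OF 1 this] show ?thesis
  proof (rule hO_cong[rotated], intro always_eventually allI)
    have "vdiv (z h - (y + h *\<^sub>R ?v)) r = vdiv (z h) r - vdiv (y + h *\<^sub>R ?v) r" for h r
      by (simp add: vec_eq_iff diff_divide_distrib)
    then show "patankar_op P (vdiv (z h) (\<sigma> y y (x h)) - 1) - patankar_op P (vdiv (z h - (y + h *\<^sub>R ?v)) (\<sigma> y y (x h)))
      = patankar_op P (vdiv (y + h *\<^sub>R ?v) (\<sigma> y y (x h)) - 1)" for h
      by (simp only: flip: patankar_op_diff) (simp add: algebra_simps)
  qed
qed

text \<open>The component \<open>m\<close> of the operator for one rate from \<open>\<nu>\<close> to
  \<open>m\<close> is the component \<open>\<nu>\<close> of its argument, which turns
  \<open>const_rates\<close> into an estimate for one weight.\<close>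

lemma single_rate:
  assumes m: "m \<noteq> \<nu>" and P: "P = (\<lambda>i j. if i = m \<and> j = \<nu> then 1 else 0)"
    and y: "y \<in> positive_vectors" and x: "stage_curve P y x"
  shows "hO 2 (\<lambda>h. (y $ \<nu> - h) / \<sigma> y y (x h) $ \<nu> - 1)"
proof -
  have "hO 2 (\<lambda>h. patankar_op P (vdiv (y + h *\<^sub>R patankar_op P 1) (\<sigma> y y (x h)) - 1))"
    using m by (intro const_rates[OF _ _ y x]) (auto simp: P)
  then have "hO 2 (\<lambda>h. patankar_op P (vdiv (y + h *\<^sub>R patankar_op P 1) (\<sigma> y y (x h)) - 1) $ m)"
    by (simp add: hO_vec_iff)
  then show ?thesis by (simp add: patankar_op_single[OF m P])
qed

text \<open>The limit of \<open>single_rate\<close> as \<open>h\<close> tends to 0. Two components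
  are required for a rate out of \<open>\<nu>\<close> to exist.\<close>

lemma \<sigma>_diag:
  assumes card: "CARD('n) \<ge> 2" and y: "y \<in> positive_vectors"
  shows "\<sigma> y y y = y"
  unfolding vec_eq_iff
proof
  fix \<nu> :: 'n
  obtain m :: 'n where m: "m \<noteq> \<nu>"
    using ex_other_index[OF card] by blast
  define P :: "'n \<Rightarrow> 'n \<Rightarrow> real" where "P = (\<lambda>i j. if i = m \<and> j = \<nu> then 1 else 0)"
  obtain x where x: "stage_curve P y x" using stage_curve_exists by blast
  have s: "\<sigma> y y y $ \<nu> > 0" using \<sigma>_pos[OF y y y] by (simp add: positive_vectors_def)
  have "hO (Suc 1) (\<lambda>h. (y $ \<nu> - h) / \<sigma> y y (x h) $ \<nu> - 1)"
    using single_rate[OF m P_def y x] by (simp add: numeral_2_eq_2)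
  then have "((\<lambda>h. (y $ \<nu> - h) / \<sigma> y y (x h) $ \<nu> - 1) \<longlongrightarrow> 0) (at_right 0)"
    by (rule hO_Suc_tendsto_0)
  moreover have "((\<lambda>h. (y $ \<nu> - h) / \<sigma> y y (x h) $ \<nu> - 1) \<longlongrightarrow> (y $ \<nu> - 0) / \<sigma> y y y $ \<nu> - 1) (at_right 0)"
    using s by (intro tendsto_intros \<sigma>_tendsto[OF y stage_curve_tendsto[OF x]]) auto
  ultimately have "(y $ \<nu> - 0) / \<sigma> y y y $ \<nu> - 1 = 0"
    by (rule tendsto_unique[OF trivial_limit_at_right_real, rotated])
  then show "\<sigma> y y y $ \<nu> = y $ \<nu>" using s by simp
qed

text \<open>With \<open>c = y $ \<nu>\<close>, the rate \<open>x $ \<nu> / c\<close> equals 1 at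
  \<open>y\<close>, so \<open>single_rate\<close> holds along the same stage curve. The exact
  solution fixes the linear coefficient of the averaged rate at \<open>- 1 / (2 * c)\<close>, while
  the second stage makes it \<open>- b 2 * a 2 1 / r\<close>; hence \<open>r = c\<close>.\<close>

lemma \<rho>_diag:
  assumes card: "CARD('n) \<ge> 2" and y: "y \<in> positive_vectors"
  shows "\<rho> y y = y"
  unfolding vec_eq_iff
proof
  fix \<nu> :: 'n
  obtain m :: 'n where m: "m \<noteq> \<nu>"
    using ex_other_index[OF card] by blast
  define P :: "'n \<Rightarrow> 'n \<Rightarrow> real" where "P = (\<lambda>i j. if i = m \<and> j = \<nu> then 1 else 0)"
  note single = patankar_op_single[OF m P_def]
  obtain x where x: "stage_curve P y x" using stage_curve_exists by blast
  define c where "c = y $ \<nu>"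
  have c: "c > 0" using y by (simp add: c_def positive_vectors_def)
  define r where "r = \<rho> y y $ \<nu>"
  have r: "r > 0" using \<rho>_pos[OF y y] by (simp add: r_def positive_vectors_def)
  let ?p = "\<lambda>i j x. P i j * (x $ \<nu> / c)" and ?d = "\<lambda>i j x. P j i * (x $ \<nu> / c)"
  have pds: "pds D ?p ?d"
    using m c by (intro pds_scaled pos_D)
      (auto simp: P_def positive_vectors_def less_imp_le intro!: bounded_linear_divide[THEN bounded_linear_compose] bounded_linear_vec_nth)
  have py: "(\<lambda>i j. ?p i j y) = P" using c by (simp add: c_def)
  \<comment> \<open>The exact solution: component \<open>\<nu>\<close> decays like
    \<open>c * exp (- h / c)\<close>, and the lost amount goes to \<open>m\<close>.\<close>
  define s where "s h = y + (c * (1 - exp (- h / c))) *\<^sub>R patankar_op P 1" for h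
  have s\<nu>: "s h $ \<nu> = c * exp (- h / c)" for h
    by (simp add: s_def single c_def algebra_simps)
  have rhs: "pds_rhs ?p ?d u = (u $ \<nu> / c) *\<^sub>R patankar_op P 1" if "u \<in> positive_vectors" for u
  proof -
    have "pds_rhs ?p ?d u = patankar_op (\<lambda>m \<nu>'. (u $ \<nu> / c) * P m \<nu>') 1"
      using that pos_D by (subst pds_rhs_eq_patankar_op[OF pds]) (auto simp: mult.commute)
    then show ?thesis by (simp only: patankar_op_scale_rate)
  qed
  have "local_solution (pds_rhs ?p ?d) positive_vectors 0 s"
  proof (rule local_solution_open[OF open_positive_vectors])
    have *: "s = (\<lambda>h. y + (c * (1 - exp (- h / c))) *\<^sub>R patankar_op P 1)" by (rule ext) (rule s_def)
    show "continuous_on UNIV s" unfolding * using c by (auto intro!: continuous_intros)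
    show "(s has_vector_derivative pds_rhs ?p ?d (s h)) (at h)" if "s h \<in> positive_vectors" for h
    proof -
      have "((\<lambda>h. c * (1 - exp (- h / c))) has_field_derivative exp (- h / c)) (at h)"
        using c by (auto intro!: derivative_eq_intros)
      from has_vector_derivative_add[OF has_vector_derivative_const
          has_vector_derivative_scaleR[OF this has_vector_derivative_const]]
      show ?thesis unfolding rhs[OF that] s\<nu> unfolding * using c by simp
    qed
  qed (simp add: s_def y)
  from order_two_expansion[OF pds y this] x obtain z where
    z: "\<forall>\<^sub>F h in at_right 0. z h = y + h *\<^sub>R patankar_op (\<lambda>i j. b 1 * ?p i j y + b 2 * ?p i j (x h)) (vdiv (z h) (\<sigma> y y (x h)))"
    and z3: "hO 3 (\<lambda>h. z h - s h)" unfolding py by (auto simp: s_def)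
  \<comment> \<open>The Runge-Kutta average \<open>u\<close> of the rate and the Patankar weight
    \<open>q\<close> enter component \<open>\<nu>\<close> of the update only through their
    product.\<close>
  define u where "u h = b 1 + b 2 * (x h $ \<nu> / c)" for h
  define q where "q h = z h $ \<nu> / \<sigma> y y (x h) $ \<nu>" for h
  have z\<nu>: "\<forall>\<^sub>F h in at_right 0. z h $ \<nu> = c - h * (u h * q h)"
    using z
  proof eventually_elim
    case (elim h)
    have "(\<lambda>i j. b 1 * ?p i j y + b 2 * ?p i j (x h)) = (\<lambda>i j. u h * P i j)"
      using c by (intro ext) (simp add: u_def c_def algebra_simps)
    then have "z h = y + h *\<^sub>R (u h *\<^sub>R patankar_op P (vdiv (z h) (\<sigma> y y (x h))))"
      using elim by (simp add: patankar_op_scale_rate)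
    then have "z h $ \<nu> = (y + h *\<^sub>R (u h *\<^sub>R patankar_op P (vdiv (z h) (\<sigma> y y (x h))))) $ \<nu>" by (rule arg_cong)
    then show ?case by (simp add: single c_def q_def)
  qed
  have x\<nu>: "\<forall>\<^sub>F h in at_right 0. x h $ \<nu> = c - h * (a 2 1 * (x h $ \<nu> / r))"
    using x[unfolded stage_curve_def]
  proof eventually_elim
    case (elim h)
    then have "x h $ \<nu> = (y + h *\<^sub>R patankar_op (\<lambda>m \<nu>. a 2 1 * P m \<nu>) (vdiv (x h) (\<rho> y y))) $ \<nu>" by (rule arg_cong)
    then show ?case by (simp add: patankar_op_scale_rate single c_def r_def)
  qed
  have zexp: "hO 3 (\<lambda>h. z h $ \<nu> - (c - h + h\<^sup>2 / (2 * c)))"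
  proof -
    have sol: "local_solution (\<lambda>u. - u / c) UNIV 0 (\<lambda>h. c * exp (- h / c))"
    proof -
      have "((\<lambda>h. c * exp (- h / c)) has_real_derivative - (c * exp (- h / c)) / c) (at h within A)" for h A
        using c by (auto intro!: derivative_eq_intros)
      then show ?thesis unfolding local_solution_def has_real_derivative_iff_has_vector_derivative
        by (intro exI[of _ 1]) auto
    qed
    have "bounded_linear (\<lambda>u. - u / c)"
      by (intro bounded_linear_divide[THEN bounded_linear_compose] bounded_linear_minus bounded_linear_ident)
    from solution_expansion[OF sol this, of 1 0]
    have "hO 3 (\<lambda>h. c * exp (- (0 + h) / c) - c * exp (- 0 / c) - h *\<^sub>R (- (c * exp (- 0 / c)) / c)
        - (h\<^sup>2 / 2) *\<^sub>R (- (- (c * exp (- 0 / c)) / c) / c))"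
      by (simp add: diff_divide_distrib)
    then have "hO 3 (\<lambda>h. c * exp (- h / c) - (c - h + h\<^sup>2 / (2 * c)))"
      by (rule hO_eq) (use c in simp)
    moreover have "hO 3 (\<lambda>h. (z h - s h) $ \<nu>)" using z3 by (simp only: hO_vec_iff)
    then have "hO 3 (\<lambda>h. z h $ \<nu> - c * exp (- h / c))" by (rule hO_eq) (simp add: s\<nu>)
    ultimately have "hO 3 (\<lambda>h. (z h $ \<nu> - c * exp (- h / c)) + (c * exp (- h / c) - (c - h + h\<^sup>2 / (2 * c))))"
      by (intro hO_add)
    then show ?thesis by (rule hO_eq) simp
  qed
  \<comment> \<open>\<open>z h $ \<nu>\<close> and \<open>c - h\<close> differ by
    \<open>O(h^2)\<close>, and \<open>single_rate\<close> says that \<open>c - h\<close> divided by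
    the denominator is \<open>1 + O(h^2)\<close>. This separates \<open>u\<close> from
    \<open>q\<close>.\<close>
  have q: "hO 2 (\<lambda>h. q h - 1)"
  proof -
    have "hO 2 (\<lambda>h. h\<^sup>2 / (2 * c))" using hO_mult[OF hO_power[of 2] hO_const[of "1 / (2 * c)"]] by simp
    moreover have "hO 2 (\<lambda>h. z h $ \<nu> - (c - h + h\<^sup>2 / (2 * c)))" by (rule hO_mono[OF zexp]) simp
    ultimately have "hO 2 (\<lambda>h. h\<^sup>2 / (2 * c) + (z h $ \<nu> - (c - h + h\<^sup>2 / (2 * c))))" by (rule hO_add)
    then have "hO 2 (\<lambda>h. z h $ \<nu> - (c - h))" by (rule hO_eq) simp
    moreover have "hO 0 (\<lambda>h. 1 / \<sigma> y y (x h) $ \<nu>)" by (rule inverse_\<sigma>_hO[OF y x])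
    ultimately have "hO (2 + 0) (\<lambda>h. (z h $ \<nu> - (c - h)) * (1 / \<sigma> y y (x h) $ \<nu>))" by (rule hO_mult)
    then have "hO 2 (\<lambda>h. (z h $ \<nu> - (c - h)) * (1 / \<sigma> y y (x h) $ \<nu>))" by (simp only: add_0_right)
    then have "hO 2 (\<lambda>h. (z h $ \<nu> - (c - h)) * (1 / \<sigma> y y (x h) $ \<nu>) + ((c - h) / \<sigma> y y (x h) $ \<nu> - 1))"
      using single_rate[OF m P_def y x] unfolding c_def[symmetric] by (rule hO_add)
    then show ?thesis by (rule hO_eq) (simp add: q_def diff_divide_distrib)
  qed
  have uq: "hO 2 (\<lambda>h. u h * q h - (1 - h / (2 * c)))"
  proof (rule hO_step_cancel, rule hO_cong)
    show "hO (Suc 2) (\<lambda>h. - (z h $ \<nu> - (c - h + h\<^sup>2 / (2 * c))))" unfolding hO_minus_iff using zexp by simp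
    show "\<forall>\<^sub>F h in at_right 0. - (z h $ \<nu> - (c - h + h\<^sup>2 / (2 * c))) = h *\<^sub>R (u h * q h - (1 - h / (2 * c)))"
      using z\<nu>
    proof eventually_elim
      case (elim h)
      show ?case unfolding elim by (simp add: algebra_simps power2_eq_square)
    qed
  qed
  have xlim: "((\<lambda>h. x h $ \<nu>) \<longlongrightarrow> c) (at_right 0)"
    unfolding c_def by (intro tendsto_intros stage_curve_tendsto[OF x])
  have "hO 0 u"
  proof (rule hO_tendsto)
    show "(u \<longlongrightarrow> b 1 + b 2 * (c / c)) (at_right 0)"
      unfolding u_def using c by (intro tendsto_intros xlim) auto
  qed
  from hO_mult[OF this q] have "hO 2 (\<lambda>h. u h * (q h - 1))" by (simp only: add_0)
  from hO_diff[OF uq this] have u: "hO 2 (\<lambda>h. u h - (1 - h / (2 * c)))"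
    by (rule hO_eq) (simp add: algebra_simps)
  have "hO 1 (\<lambda>h. 1 / (2 * c) - b 2 * (a 2 1 * (x h $ \<nu> / r)) / c)"
  proof (rule hO_step_cancel, rule hO_cong)
    show "hO (Suc 1) (\<lambda>h. u h - (1 - h / (2 * c)))" using u by (simp add: numeral_2_eq_2)
    show "\<forall>\<^sub>F h in at_right 0. u h - (1 - h / (2 * c)) = h *\<^sub>R (1 / (2 * c) - b 2 * (a 2 1 * (x h $ \<nu> / r)) / c)"
      using x\<nu>
    proof eventually_elim
      case (elim h)
      \<comment> \<open>The stage equation is inserted once; the occurrence of
        \<open>x h $ \<nu>\<close> that remains is needed only through its limit
        \<open>c\<close>.\<close>
      have "u h = b 1 + b 2 * ((c - h * (a 2 1 * (x h $ \<nu> / r))) / c)"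
        unfolding u_def by (subst (1) elim) simp
      also have "\<dots> = (b 1 + b 2) - h * (b 2 * (a 2 1 * (x h $ \<nu> / r)) / c)"
        using c by (simp add: diff_divide_distrib algebra_simps)
      finally show ?case using b_sum by (simp add: algebra_simps)
    qed
  qed
  then have "hO (Suc 0) (\<lambda>h. 1 / (2 * c) - b 2 * (a 2 1 * (x h $ \<nu> / r)) / c)" by simp
  from hO_Suc_tendsto_0[OF this]
  have "((\<lambda>h. 1 / (2 * c) - b 2 * (a 2 1 * (x h $ \<nu> / r)) / c) \<longlongrightarrow> 0) (at_right 0)" .
  moreover have "((\<lambda>h. 1 / (2 * c) - b 2 * (a 2 1 * (x h $ \<nu> / r)) / c) \<longlongrightarrow> 1 / (2 * c) - b 2 * (a 2 1 * (c / r)) / c) (at_right 0)"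
    using r c by (intro tendsto_intros xlim) auto
  ultimately have "1 / (2 * c) - b 2 * (a 2 1 * (c / r)) / c = 0"
    by (rule tendsto_unique[OF trivial_limit_at_right_real, rotated])
  then have "1 / (2 * c) = (b 2 * a 2 1) * (c / r) / c" by simp
  then show "\<rho> y y $ \<nu> = y $ \<nu>" unfolding b_a using r c by (simp add: field_simps flip: r_def c_def)
qed

text \<open>\<open>const_rates\<close> determines the error of the weights only up to the kernel of
  the operator. The rates \<open>q\<close> detect every deviation from a multiple of the all-ones
  vector, and a nonzero component of \<open>F\<close> controls that multiple.\<close>

lemma \<sigma>_expansion:
  assumes card: "CARD('n) \<ge> 2" and P: "\<And>m \<nu>. P m \<nu> \<ge> 0" "\<And>m. P m m = 0"
    and y: "y \<in> positive_vectors" and x: "stage_curve P y x"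
  shows "hO 2 (\<lambda>h. \<sigma> y y (x h) - (y + h *\<^sub>R patankar_op P 1))"
proof (cases "patankar_op P 1 = 0")
  case True
  have \<rho>: "\<rho> y y = y" by (rule \<rho>_diag[OF card y])
  have y0: "y $ \<nu> \<noteq> 0" for \<nu> using y by (auto simp: positive_vectors_def dest: less_imp_neq spec[of _ \<nu>])
  have "vdiv y y = 1" by (simp add: vec_eq_iff y0)
  then have stat: "patankar_op (\<lambda>m \<nu>. a 2 1 * P m \<nu> / y $ \<nu>) y = 0"
    using True by (simp add: patankar_op_vdiv[symmetric] patankar_op_scale_rate)
  \<comment> \<open>Since \<open>\<rho> y y = y\<close>, the weights at \<open>y\<close> are 1 and
    \<open>y\<close> itself solves the stage equation.\<close>
  have "\<forall>\<^sub>F h in at_right 0. x h = y"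
    using patankar_op_curve_stationary[of "\<lambda>_ m \<nu>. a 2 1 * P m \<nu> / y $ \<nu>" x y, OF hO_const _ stat] x
    unfolding stage_curve_def \<rho> patankar_op_vdiv by blast
  then have "\<forall>\<^sub>F h in at_right 0. 0 = \<sigma> y y (x h) - (y + h *\<^sub>R patankar_op P 1)"
    by eventually_elim (simp add: True \<sigma>_diag[OF card y])
  then show ?thesis by (rule hO_cong) (rule hO_zero)
next
  case False
  define F where "F = patankar_op P 1"
  obtain k where k: "F $ k \<noteq> 0" using False by (auto simp: F_def vec_eq_iff)
  have \<rho>: "\<rho> y y = y" by (rule \<rho>_diag[OF card y])
  have ypos: "y $ \<nu> > 0" for \<nu> using y by (simp add: positive_vectors_def)
  define S where "S = (\<Sum>\<nu>\<in>UNIV. y $ \<nu>)"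
  have S: "S > 0" unfolding S_def by (rule sum_pos) (auto simp: ypos)
  define q where "q m \<nu> = y $ m * y $ \<nu> / S" for m \<nu>
  define P' where "P' = (\<lambda>m \<nu>. if m = \<nu> then 0 else P m \<nu> + q m \<nu>)"
  define \<alpha> where "\<alpha> = a 2 1"
  have \<alpha>: "\<alpha> \<ge> 0" using a_nonneg by (simp add: \<alpha>_def)
  have op_P': "patankar_op P' u = patankar_op P u + patankar_op q u" for u
    unfolding P'_def patankar_op_zero_diag patankar_op_add_rate ..
  \<comment> \<open>Up to the factor \<open>y $ m\<close>, the operator of \<open>q\<close> compares
    the \<open>y\<close>-weighted mean of \<open>u\<close> with \<open>u $ m\<close>; its kernel
    consists of the multiples of 1.\<close>
  have op_q: "patankar_op q u $ m = y $ m * ((\<Sum>\<nu>\<in>UNIV. y $ \<nu> * u $ \<nu>) / S - u $ m)" for u m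
  proof -
    have "patankar_op q u $ m = (\<Sum>\<nu>\<in>UNIV. (y $ m / S) * (y $ \<nu> * u $ \<nu>) - (y $ m * u $ m / S) * y $ \<nu>)"
      by (simp add: patankar_op_def q_def mult_ac)
    also have "\<dots> = (y $ m / S) * (\<Sum>\<nu>\<in>UNIV. y $ \<nu> * u $ \<nu>) - (y $ m * u $ m / S) * S"
      by (simp only: sum_subtractf sum_distrib_left[symmetric] S_def[symmetric])
    also have "\<dots> = y $ m * ((\<Sum>\<nu>\<in>UNIV. y $ \<nu> * u $ \<nu>) / S - u $ m)"
      using S by (simp add: field_simps)
    finally show ?thesis .
  qed
  have "patankar_op q 1 = 0" using S by (simp add: vec_eq_iff op_q S_def[symmetric])
  then have F': "patankar_op P' 1 = F" by (simp add: op_P' F_def)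
  \<comment> \<open>The second stage for \<open>P'\<close> at step size \<open>h\<close> is the one
    for \<open>P\<close> at \<open>\<psi> h\<close>; \<open>\<phi>\<close> inverts
    \<open>\<psi>\<close> for small \<open>h\<close>.\<close>
  define \<psi> where "\<psi> h = h / (1 + \<alpha> * h)" for h
  define \<phi> where "\<phi> h = h / (1 - \<alpha> * h)" for h
  have small: "\<forall>\<^sub>F h in at_right 0. 0 < h \<and> \<alpha> * h \<le> 1 / 2"
  proof (rule eventually_at_right_0[of "1 / (2 * (\<alpha> + 1))"])
    fix h :: real assume h: "0 < h" "h < 1 / (2 * (\<alpha> + 1))"
    then have "h * (2 * (\<alpha> + 1)) < 1" using \<alpha> by (simp add: field_simps)
    with h(1) show "0 < h \<and> \<alpha> * h \<le> 1 / 2" by (simp add: algebra_simps)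
  qed (use \<alpha> in simp)
  have \<psi>_lim: "filterlim \<psi> (at_right 0) (at_right 0)"
    unfolding filterlim_at
  proof
    show "\<forall>\<^sub>F h in at_right 0. \<psi> h \<in> {0<..} \<and> \<psi> h \<noteq> 0"
      using small
    proof eventually_elim
      case (elim h)
      have "1 + \<alpha> * h > 0" using elim \<alpha> by (intro add_pos_nonneg mult_nonneg_nonneg) auto
      then show ?case using elim by (simp add: \<psi>_def)
    qed
    have "(\<psi> \<longlongrightarrow> 0 / (1 + \<alpha> * 0)) (at_right 0)" unfolding \<psi>_def by (intro tendsto_intros) auto
    then show "(\<psi> \<longlongrightarrow> 0) (at_right 0)" by simp
  qed
  have \<phi>_lim: "filterlim \<phi> (at_right 0) (at_right 0)"
    unfolding filterlim_at
  proof
    show "\<forall>\<^sub>F h in at_right 0. \<phi> h \<in> {0<..} \<and> \<phi> h \<noteq> 0"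
      using small by eventually_elim (auto simp: \<phi>_def)
    have "(\<phi> \<longlongrightarrow> 0 / (1 - \<alpha> * 0)) (at_right 0)" unfolding \<phi>_def by (intro tendsto_intros) auto
    then show "(\<phi> \<longlongrightarrow> 0) (at_right 0)" by simp
  qed
  have inv: "hO 0 (\<lambda>h. 1 / (1 - \<alpha> * h))"
  proof (rule hO_tendsto)
    show "((\<lambda>h. 1 / (1 - \<alpha> * h)) \<longlongrightarrow> 1 / (1 - \<alpha> * 0)) (at_right 0)" by (intro tendsto_intros) auto
  qed
  have \<phi>1: "hO 1 \<phi>"
    using hO_step[OF inv] unfolding One_nat_def by (rule hO_eq) (simp add: \<phi>_def)
  have \<phi>2: "hO 2 (\<lambda>h. \<phi> h - h)"
  proof (rule hO_cong)
    have "hO 0 (\<lambda>h. \<alpha> * (1 / (1 - \<alpha> * h)))" using hO_mult[OF hO_const inv] by simp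
    from hO_step[OF hO_step[OF this]] show "hO 2 (\<lambda>h. h *\<^sub>R h *\<^sub>R (\<alpha> * (1 / (1 - \<alpha> * h))))"
      by (simp only: numeral_2_eq_2)
    show "\<forall>\<^sub>F h in at_right 0. h *\<^sub>R h *\<^sub>R (\<alpha> * (1 / (1 - \<alpha> * h))) = \<phi> h - h"
      using small by eventually_elim (simp add: \<phi>_def field_simps)
  qed
  have x': "stage_curve P' y (\<lambda>h. x (\<psi> h))"
  proof -
    have "\<forall>\<^sub>F h in at_right 0. x (\<psi> h) = y + \<psi> h *\<^sub>R patankar_op (\<lambda>m \<nu>. a 2 1 * P m \<nu>) (vdiv (x (\<psi> h)) y)"
      using x \<psi>_lim unfolding stage_curve_def \<rho> filterlim_iff by blast
    then show ?thesis unfolding stage_curve_def \<rho> patankar_op_scale_rate \<alpha>_def[symmetric]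
      using small
    proof eventually_elim
      case (elim h)
      define X where "X = x (\<psi> h)"
      define G where "G = patankar_op P (vdiv X y)"
      have X: "X - y = (\<alpha> * \<psi> h) *\<^sub>R G"
      proof -
        have "X - y = \<psi> h *\<^sub>R \<alpha> *\<^sub>R patankar_op P (vdiv X y)"
          unfolding X_def by (subst elim(1)) simp
        then show ?thesis by (simp add: G_def mult.commute)
      qed
      have "(\<Sum>\<nu>\<in>UNIV. (X - y) $ \<nu>) = 0"
        unfolding X by (simp add: G_def sum_patankar_op flip: sum_distrib_left)
      then have "(\<Sum>\<nu>\<in>UNIV. X $ \<nu>) = S" by (simp add: S_def sum_subtractf)
      moreover have "y $ \<nu> * (X $ \<nu> / y $ \<nu>) = X $ \<nu>" for \<nu> using ypos[of \<nu>] by simp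
      \<comment> \<open>By conservation \<open>X\<close> has the same component sum as
        \<open>y\<close>, so the weighted mean of \<open>X / y\<close> is 1. The extra rates thus
        act on \<open>X / y\<close> as \<open>y - X\<close>, a multiple of \<open>G\<close>, and
        only rescale the step size.\<close>
      ultimately have "patankar_op q (vdiv X y) = y - X"
        using S by (simp add: vec_eq_iff op_q right_diff_distrib)
      then have "patankar_op P' (vdiv X y) = G - (X - y)" by (simp add: op_P' G_def)
      also have "\<dots> = (1 - \<alpha> * \<psi> h) *\<^sub>R G" by (simp add: X scaleR_diff_left)
      finally have "h *\<^sub>R \<alpha> *\<^sub>R patankar_op P' (vdiv X y) = (h * \<alpha> * (1 - \<alpha> * \<psi> h)) *\<^sub>R G" by simp
      moreover have "h * \<alpha> * (1 - \<alpha> * \<psi> h) = \<alpha> * \<psi> h"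
      proof -
        have "1 + \<alpha> * h > 0" using elim(2) \<alpha> by (intro add_pos_nonneg mult_nonneg_nonneg) auto
        then show ?thesis by (simp add: \<psi>_def field_simps)
      qed
      ultimately have "h *\<^sub>R \<alpha> *\<^sub>R patankar_op P' (vdiv X y) = X - y" by (simp only: X)
      then show ?case by (simp add: X_def)
    qed
  qed
  define \<theta> where "\<theta> h = vdiv (y + h *\<^sub>R F) (\<sigma> y y (x h)) - 1" for h
  have \<theta>P: "hO 2 (\<lambda>h. patankar_op P (\<theta> h))"
    unfolding \<theta>_def F_def by (rule const_rates[OF P y x])
  have "hO 2 (\<lambda>h. patankar_op P' (vdiv (y + h *\<^sub>R F) (\<sigma> y y (x (\<psi> h))) - 1))"
    unfolding F'[symmetric] using P ypos S
    by (intro const_rates[OF _ _ y x']) (auto simp: P'_def q_def less_imp_le)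
  from hO_compose[OF this \<phi>_lim \<phi>1]
  have \<theta>': "hO 2 (\<lambda>h. patankar_op P' (vdiv (y + \<phi> h *\<^sub>R F) (\<sigma> y y (x (\<psi> (\<phi> h)))) - 1))" .
  have "hO 0 (\<lambda>h. 1 / \<sigma> y y (x h) $ \<nu>)" for \<nu> by (rule inverse_\<sigma>_hO[OF y x])
  \<comment> \<open>After substituting \<open>\<phi>\<close>, both estimates use the denominator at
    \<open>x h\<close>. The remaining mismatch between \<open>\<phi> h\<close> and \<open>h\<close>
    in the numerator is of second order.\<close>
  moreover have "hO 2 (\<lambda>h. (\<phi> h - h) *\<^sub>R F)" using hO_scaleR[OF \<phi>2 hO_const] by simp
  ultimately have "hO 2 (\<lambda>h. vdiv ((\<phi> h - h) *\<^sub>R F) (\<sigma> y y (x h)))" by (rule hO_vdiv)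
  from hO_patankar_op[of 0 "\<lambda>_. P'", OF hO_const this]
  have "hO 2 (\<lambda>h. patankar_op P' (vdiv ((\<phi> h - h) *\<^sub>R F) (\<sigma> y y (x h))))" by (simp only: add_0)
  from hO_diff[OF \<theta>' this] have \<theta>P': "hO 2 (\<lambda>h. patankar_op P' (\<theta> h))"
  proof (rule hO_cong[rotated])
    show "\<forall>\<^sub>F h in at_right 0. patankar_op P' (vdiv (y + \<phi> h *\<^sub>R F) (\<sigma> y y (x (\<psi> (\<phi> h)))) - 1)
        - patankar_op P' (vdiv ((\<phi> h - h) *\<^sub>R F) (\<sigma> y y (x h))) = patankar_op P' (\<theta> h)"
      using small
    proof eventually_elim
      case (elim h)
      have "\<psi> (\<phi> h) = h" using elim by (simp add: \<phi>_def \<psi>_def field_simps)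
      moreover have "vdiv (y + \<phi> h *\<^sub>R F) r - 1 - vdiv ((\<phi> h - h) *\<^sub>R F) r = vdiv (y + h *\<^sub>R F) r - 1" for r
        by (simp add: vec_eq_iff add_divide_distrib diff_divide_distrib left_diff_distrib)
      ultimately show ?case unfolding patankar_op_diff[symmetric] \<theta>_def by (simp only:)
    qed
  qed
  \<comment> \<open>The \<open>y\<close>-weighted mean of \<open>\<theta>\<close>: the multiple of 1
    from which the operator of \<open>q\<close> measures the deviation.\<close>
  define l where "l h = (\<Sum>\<nu>\<in>UNIV. y $ \<nu> * \<theta> h $ \<nu>) / S" for h
  have dev: "hO 2 (\<lambda>h. \<theta> h - l h *\<^sub>R 1)"
    unfolding hO_vec_iff
  proof
    fix m
    have "hO 2 (\<lambda>h. patankar_op P' (\<theta> h) - patankar_op P (\<theta> h))" by (rule hO_diff[OF \<theta>P' \<theta>P])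
    then have "hO 2 (\<lambda>h. patankar_op q (\<theta> h) $ m)" by (simp add: op_P' hO_vec_iff)
    from hO_mult[OF hO_const this, of "- 1 / y $ m"]
    have "hO 2 (\<lambda>h. - 1 / y $ m * patankar_op q (\<theta> h) $ m)" by (simp only: add_0)
    then show "hO 2 (\<lambda>h. (\<theta> h - l h *\<^sub>R 1) $ m)"
      by (rule hO_eq) (use ypos[of m] in \<open>simp add: op_q l_def\<close>)
  qed
  from hO_patankar_op[of 0 "\<lambda>_. P", OF hO_const this]
  have "hO 2 (\<lambda>h. patankar_op P (\<theta> h - l h *\<^sub>R 1))" by (simp only: add_0)
  \<comment> \<open>The difference is the operator of \<open>P\<close> applied to \<open>l h\<close>
    times the all-ones vector, which is \<open>l h\<close> times \<open>F\<close>.\<close>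
  from hO_diff[OF \<theta>P this] have "hO 2 (\<lambda>h. l h *\<^sub>R F)"
    by (rule hO_eq) (simp add: patankar_op_diff patankar_op_scaleR F_def)
  then have "hO 2 (\<lambda>h. l h * F $ k)" by (simp add: hO_vec_iff)
  from hO_mult[OF this hO_const[of "1 / F $ k"]] have "hO 2 l"
    unfolding add_0_right by (rule hO_eq) (use k in simp)
  from hO_add[OF dev hO_scaleR[OF this hO_const[of 1], unfolded add_0_right]]
  have "hO 2 \<theta>" by (rule hO_eq) simp
  then have "hO 2 (\<lambda>h. (y + h *\<^sub>R F) - \<sigma> y y (x h))"
    unfolding \<theta>_def
    by (rule hO_of_vdiv_one[OF \<sigma>_tendsto[OF y stage_curve_tendsto[OF x]] \<sigma>_pos[OF y y y]])
  then have "hO 2 (\<lambda>h. - ((y + h *\<^sub>R F) - \<sigma> y y (x h)))" unfolding hO_minus_iff .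
  then show ?thesis by (rule hO_eq) (simp add: F_def)
qed

end
end

section \<open>Equivalence of order two and the conditions on the denominators\<close>

theorem theorem18:
  fixes a :: "nat \<Rightarrow> nat \<Rightarrow> real" and b c :: "nat \<Rightarrow> real"
    and \<rho> :: "real ^ 'n::finite \<Rightarrow> real ^ 'n \<Rightarrow> real ^ 'n"
    and \<sigma> :: "real ^ 'n \<Rightarrow> real ^ 'n \<Rightarrow> real ^ 'n \<Rightarrow> real ^ 'n"
    and D :: "(real ^ 'n) set"
  assumes "CARD('n) \<ge> 2"
    and "open D" and "positive_vectors \<subseteq> D"
    and "explicit_tableau 2 a c"
    and "\<forall>i\<in>{1..2}. \<forall>j\<in>{1..2}. a i j \<ge> 0" and "\<forall>j\<in>{1..2}. b j \<ge> 0"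
    and "rk_order TYPE(real ^ 'n) 2 2 a b"
    and "continuous_on (positive_vectors \<times> positive_vectors) (\<lambda>(y, y1). \<rho> y y1)"
    and "continuous_on (positive_vectors \<times> positive_vectors \<times> positive_vectors)
           (\<lambda>(y, y1, y2). \<sigma> y y1 y2)"
    and "\<forall>y\<in>positive_vectors. \<forall>y1\<in>positive_vectors. \<rho> y y1 \<in> positive_vectors"
    and "\<forall>y\<in>positive_vectors. \<forall>y1\<in>positive_vectors. \<forall>y2\<in>positive_vectors.
           \<sigma> y y1 y2 \<in> positive_vectors"
  shows "(\<forall>p d. pds D p d \<longrightarrow>
            has_order 2 (mprk_step p d 2 a b (\<lambda>i y Y. \<rho> y (Y 1)) (\<lambda>y Y. \<sigma> y (Y 1) (Y 2)))
              (pds_rhs p d) positive_vectors)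
     \<longleftrightarrow>
         (\<forall>p d y Y. pds D p d \<and> y \<in> positive_vectors \<and>
            (\<forall>\<^sub>F h in at_right 0. mprk_stages p d 2 a (\<lambda>i y Y. \<rho> y (Y 1)) h y (Y h)) \<longrightarrow>
            (\<forall>\<nu>. (\<lambda>h. \<rho> y (Y h 1) $ \<nu> - y $ \<nu>) \<in> O[at_right 0](\<lambda>h. h)) \<and>
            (\<forall>\<mu>. (\<lambda>h. \<sigma> y (Y h 1) (Y h 2) $ \<mu> - NB1 p d h y $ \<mu>) \<in> O[at_right 0](\<lambda>h. h\<^sup>2)))"
proof -
  have D: "open D" "positive_vectors \<subseteq> D" using assms(2,3) by auto
  have a0: "a 2 1 \<ge> 0" using assms(5) by simp
  note rk = rk_2_2_conditions[OF assms(4,7)]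
  interpret mprk_2 a b \<rho> \<sigma> D
    using D a0 rk assms(9-11) by unfold_locales auto
  show ?thesis (is "?order \<longleftrightarrow> ?den")
  proof
    assume ord: ?order
    then have order: "has_order 2 (step p d) (pds_rhs p d) positive_vectors" if "pds D p d" for p d
      using that by blast
    show ?den
    proof (intro allI impI, elim conjE)
      fix p d y Y
      assume pds: "pds D p d" and y: "y \<in> positive_vectors"
        and st: "\<forall>\<^sub>F h in at_right 0. stages p d h y (Y h)"
      have yD: "y \<in> D" using y D by auto
      define P where "P m \<nu> = p m \<nu> y" for m \<nu>
      have x: "stage_curve P y (\<lambda>h. Y h 2)" and Y1: "\<forall>\<^sub>F h in at_right 0. Y h 1 = y"
        using stage_curve_of_stages[OF pds y st] by (auto simp: P_def[abs_def])
      have P: "P m \<nu> \<ge> 0" "P m m = 0" for m \<nu>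
        using pds y pds_diag[OF pds yD] by (auto simp: P_def pds_def)
      have "\<forall>\<^sub>F h in at_right 0. 0 = \<rho> y (Y h 1) $ \<nu> - y $ \<nu>" for \<nu>
        using Y1 by eventually_elim (simp add: \<rho>_diag[OF order assms(1) y])
      then have "hO 1 (\<lambda>h. \<rho> y (Y h 1) $ \<nu> - y $ \<nu>)" for \<nu>
        by (rule hO_cong) (rule hO_zero)
      moreover have "hO 2 (\<lambda>h. \<sigma> y (Y h 1) (Y h 2) - NB1 p d h y)"
      proof (rule hO_cong)
        show "hO 2 (\<lambda>h. \<sigma> y y (Y h 2) - (y + h *\<^sub>R patankar_op P 1))"
          by (rule \<sigma>_expansion[OF order assms(1) P y x])
        show "\<forall>\<^sub>F h in at_right 0. \<sigma> y y (Y h 2) - (y + h *\<^sub>R patankar_op P 1) = \<sigma> y (Y h 1) (Y h 2) - NB1 p d h y"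
          using Y1 by eventually_elim
            (simp add: NB1_eq_pds_rhs pds_rhs_eq_patankar_op[OF pds yD] P_def[abs_def])
      qed
      then have "hO 2 (\<lambda>h. \<sigma> y (Y h 1) (Y h 2) $ \<mu> - NB1 p d h y $ \<mu>)" for \<mu>
        by (simp add: hO_vec_iff)
      ultimately show "(\<forall>\<nu>. (\<lambda>h. \<rho> y (Y h 1) $ \<nu> - y $ \<nu>) \<in> O[at_right 0](\<lambda>h. h)) \<and>
          (\<forall>\<mu>. (\<lambda>h. \<sigma> y (Y h 1) (Y h 2) $ \<mu> - NB1 p d h y $ \<mu>) \<in> O[at_right 0](\<lambda>h. h\<^sup>2))"
        by (simp add: hO_real_iff_bigo)
    qed
  next
    assume den: ?den
    show ?order
    proof (intro allI impI)
      fix p d assume pds: "pds D p d"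
      show "has_order 2 (step p d) (pds_rhs p d) positive_vectors"
      proof (rule order_two_of_denominators[OF pds])
        fix y Y assume y: "y \<in> positive_vectors"
          and st: "\<forall>\<^sub>F h in at_right 0. stages p d h y (Y h)"
        have Y1: "\<forall>\<^sub>F h in at_right 0. Y h 1 = y" by (rule stage_curve_of_stages(2)[OF pds y st])
        have bigo: "(\<lambda>h. \<rho> y (Y h 1) $ \<nu> - y $ \<nu>) \<in> O[at_right 0](\<lambda>h. h)"
            "(\<lambda>h. \<sigma> y (Y h 1) (Y h 2) $ \<nu> - NB1 p d h y $ \<nu>) \<in> O[at_right 0](\<lambda>h. h\<^sup>2)" for \<nu>
          using den pds y st by blast+
        \<comment> \<open>As the first stage is \<open>y\<close>, this difference does not depend on
          \<open>h\<close>, and \<open>O(h)\<close> forces it to vanish.\<close>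
        have "\<rho> y y $ \<nu> - y $ \<nu> = 0" for \<nu>
        proof (rule hO_const_Suc[of 0], rule hO_cong)
          show "hO (Suc 0) (\<lambda>h. \<rho> y (Y h 1) $ \<nu> - y $ \<nu>)"
            using bigo(1) by (simp add: hO_real_iff_bigo)
          show "\<forall>\<^sub>F h in at_right 0. \<rho> y (Y h 1) $ \<nu> - y $ \<nu> = \<rho> y y $ \<nu> - y $ \<nu>"
            using Y1 by eventually_elim simp
        qed
        then have "\<rho> y y = y" by (simp add: vec_eq_iff)
        moreover have "hO 2 (\<lambda>h. \<sigma> y y (Y h 2) - NB1 p d h y)"
        proof (rule hO_cong)
          show "hO 2 (\<lambda>h. \<sigma> y (Y h 1) (Y h 2) - NB1 p d h y)"
            using bigo(2) by (simp add: hO_vec_iff hO_real_iff_bigo)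
          show "\<forall>\<^sub>F h in at_right 0. \<sigma> y (Y h 1) (Y h 2) - NB1 p d h y = \<sigma> y y (Y h 2) - NB1 p d h y"
            using Y1 by eventually_elim simp
        qed
        ultimately show "\<rho> y y = y \<and> hO 2 (\<lambda>h. \<sigma> y y (Y h 2) - NB1 p d h y)" ..
      qed
    qed
  qed
qed

end
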